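(* Let $T$ be an irrational right triangle whose smaller angle $\alpha$ satisfies $\frac{\pi}{6}<\alpha<\frac{\pi}{4}$. Consider any perpendicular periodic beam, of period $2p$. Then: (1) the orbit at the midpoint of the beam hits the right-angle vertex of $T$ (i.e. the midpoint of the rhombus $R$); (2) the beam returns to itself after half its period with the opposite orientation (i.e. viewed in $T$, after $p$ steps the beam returns perpendicularly to the same interval of the horizontal leg from which it started, the trajectory starting at signed distance $t$ from the midpoint of this interval returning at signed distance $-t$); (3) $p$ is even and the first $p+1$ letters $a_0a_1\cdots a_p$ of the code of the beam form a palindrome.
   Context: **Triangle and rhombus.** $T$ is a right triangle placed with one leg horizontal so that its smaller angle $\alpha$ is the angle between the horizontal leg and the hypotenuse. $T$ is irrational if $\alpha/\pi\notin\mathbb{Q}$. A billiard trajectory moves with unit speed along straight lines and is reflected at the sides by the mirror law. Reflecting $T$ in the two sides of its right angle gives a rhombus $R$ made of four copies of $T$; its center is the right-angle vertex, its horizontal diagonal $L$ is twice the horizontal leg, and its angle at each end of $L$ is $2\alpha$. The billiard in $T$ is studied through the billiard in $R$; trajectories through the center of $R$ are considered as defined (they pass straight through). A trajectory is singular if it reaches a vertex of the rhombus. **Unfolding and code.** Instead of reflecting a trajectory in a side of $R$, reflect the rhombus in that side; the trajectory becomes a straight line crossing a sequence of copies of $R$. Each reflection changes the rhombus, up to translation, by a rotation by $\pm2\alpha$; a copy is labelled $k\in\mathbb{Z}$ if the total rotation is the clockwise rotation by $2\alpha k$. Formally, let $R_k$ be $R$ rotated clockwise by $2\alpha k$ about its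 center, and glue by translation each of the two sides of $R_k$ having direction angle $-(2k+1)\alpha$ to the opposite (parallel) side of $R_{k+1}$, for all $k\in\mathbb{Z}$, obtaining a surface $X$; unfolded trajectories are straight lines of a fixed direction on $X$. The code of a trajectory is the sequence $a_0,a_1,a_2,\dots$ of labels of the rhombi it successively visits (so $|a_{i+1}-a_i|=1$). All periods and lengths are counted as numbers of rhombi crossed. **Perpendicular periodic beams.** "Perpendicular" means perpendicular to the horizontal leg. A perpendicular periodic beam is a maximal-width strip of trajectories leaving an open interval $I\subset L$ of $R_0$ in the vertical direction (so $a_0=0$), all periodic and with the same code; its period is the common period of its trajectories on $X$. Perpendicular periodic beams have even period $2p$: after $p$ steps they hit a copy of $L$ perpendicularly a second time and then retrace their path in $T$. *)

theory Defs
  imports "HOL-Analysis.Analysis"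
begin

section \<open>Triangle and rhombus\<close>

text \<open>The plane is \<^typ>\<open>complex\<close>. The right-angle vertex of the triangle is the origin, its horizontal
  leg is the segment from 0 to \<open>l\<close>, and \<open>\<alpha>\<close> is the angle at \<open>l\<close>.\<close>

definition irrational_angle :: "real \<Rightarrow> bool" where
  "irrational_angle \<alpha> \<longleftrightarrow> \<alpha> / pi \<notin> \<rat>"

definition apex :: "real \<Rightarrow> real \<Rightarrow> complex" where
  "apex \<alpha> l = \<i> * of_real (l * tan \<alpha>)"

definition triangle :: "real \<Rightarrow> real \<Rightarrow> complex set" where
  "triangle \<alpha> l = convex hull {0, of_real l, apex \<alpha> l}"

definition rhombus :: "real \<Rightarrow> real \<Rightarrow> complex set" where
  "rhombus \<alpha> l = triangle \<alpha> l \<union> cnj ` triangle \<alpha> l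
     \<union> (\<lambda>z. - cnj z) ` triangle \<alpha> l \<union> uminus ` triangle \<alpha> l"

definition rot :: "real \<Rightarrow> int \<Rightarrow> complex" where
  "rot \<alpha> k = cis (- (2 * \<alpha> * of_int k))"

definition rhombus_copy :: "real \<Rightarrow> real \<Rightarrow> int \<Rightarrow> complex set" where
  "rhombus_copy \<alpha> l k = (\<lambda>z. rot \<alpha> k * z) ` rhombus \<alpha> l"

definition diagonal_copy :: "real \<Rightarrow> real \<Rightarrow> int \<Rightarrow> complex set" where
  "diagonal_copy \<alpha> l k = (\<lambda>z. rot \<alpha> k * z) ` closed_segment (of_real (- l)) (of_real l)"


section \<open>The surface\<close>

text \<open>A point of the surface is represented by a pair \<open>(k, z)\<close> with \<open>z\<close> in the \<open>k\<close>-th copy of the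
  rhombus (which is centred at 0).

  \<open>side_next \<alpha> l k e\<close>, for \<open>e = 1\<close> and \<open>e = - 1\<close>, are the two open sides of the \<open>k\<close>-th copy having
  direction angle \<open>- (2 * k + 1) * \<alpha>\<close> modulo \<open>pi\<close>; \<open>side_prev \<alpha> l k e\<close> are the other two, whose
  direction angle is \<open>- (2 * (k - 1) + 1) * \<alpha>\<close>. The lemmas below confirm this, and that the
  translation used in \<open>glue_next\<close> carries \<open>side_next \<alpha> l k e\<close> onto \<open>side_prev \<alpha> l (k + 1) e\<close>.
  The latter is the opposite side: the unrotated sides are, for \<open>e = 1\<close>, the upper right
  and the lower right one, and for \<open>e = - 1\<close> the lower left and the upper left one.\<close>

definition side_next :: "real \<Rightarrow> real \<Rightarrow> int \<Rightarrow> real \<Rightarrow> complex set" where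
  "side_next \<alpha> l k e =
     open_segment (rot \<alpha> k * of_real (e * l)) (rot \<alpha> k * (of_real e * apex \<alpha> l))"

definition side_prev :: "real \<Rightarrow> real \<Rightarrow> int \<Rightarrow> real \<Rightarrow> complex set" where
  "side_prev \<alpha> l k e =
     open_segment (rot \<alpha> k * of_real (e * l)) (rot \<alpha> k * (- (of_real e * apex \<alpha> l)))"

definition glue_next :: "real \<Rightarrow> real \<Rightarrow> int \<times> complex \<Rightarrow> int \<times> complex \<Rightarrow> bool" where
  "glue_next \<alpha> l P Q \<longleftrightarrow> (\<exists>k z. \<exists>e\<in>{1, -1}. P = (k, z) \<and> z \<in> side_next \<alpha> l k e \<and>
     Q = (k + 1, z + (rot \<alpha> (k + 1) - rot \<alpha> k) * of_real (e * l)))"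

definition glued :: "real \<Rightarrow> real \<Rightarrow> int \<times> complex \<Rightarrow> int \<times> complex \<Rightarrow> bool" where
  "glued \<alpha> l P Q \<longleftrightarrow> glue_next \<alpha> l P Q \<or> glue_next \<alpha> l Q P"

lemma rot_Suc: "rot \<alpha> (k + 1) = rot \<alpha> k * cis (- 2 * \<alpha>)"
  by (simp add: rot_def cis_mult algebra_simps)

lemma scaled_edge:
  assumes "cos \<alpha> \<noteq> 0"
  shows "apex \<alpha> l - of_real l = - of_real (l / cos \<alpha>) * cis (- \<alpha>)"
  using assms by (auto simp: complex_eq_iff apex_def tan_def field_simps)

lemma side_next_direction:
  assumes "cos \<alpha> \<noteq> 0"
  shows "rot \<alpha> k * (of_real e * apex \<alpha> l) - rot \<alpha> k * of_real (e * l)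
           = of_real (- e * l / cos \<alpha>) * cis (- (2 * of_int k + 1) * \<alpha>)"
proof -
  have "rot \<alpha> k * (of_real e * apex \<alpha> l) - rot \<alpha> k * of_real (e * l)
      = of_real e * rot \<alpha> k * (apex \<alpha> l - of_real l)"
    by (simp add: algebra_simps)
  also have "\<dots> = of_real (- e * l / cos \<alpha>) * (rot \<alpha> k * cis (- \<alpha>))"
    by (subst scaled_edge[OF assms]) (simp add: algebra_simps)
  also have "rot \<alpha> k * cis (- \<alpha>) = cis (- (2 * of_int k + 1) * \<alpha>)"
    by (simp add: rot_def cis_mult algebra_simps)
  finally show ?thesis .
qed

lemma apex_rot:
  assumes "cos \<alpha> \<noteq> 0"
  shows "apex \<alpha> l - of_real l = cis (- 2 * \<alpha>) * (- apex \<alpha> l - of_real l)"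
proof -
  have "- apex \<alpha> l - of_real l = cnj (apex \<alpha> l - of_real l)"
    by (simp add: apex_def)
  also have "\<dots> = - of_real (l / cos \<alpha>) * cis \<alpha>"
    by (subst scaled_edge[OF assms]) (simp add: cis_cnj)
  finally have "cis (- 2 * \<alpha>) * (- apex \<alpha> l - of_real l)
      = - of_real (l / cos \<alpha>) * (cis (- 2 * \<alpha>) * cis \<alpha>)"
    by (simp only: mult.left_commute)
  also have "cis (- 2 * \<alpha>) * cis \<alpha> = cis (- \<alpha>)"
    by (simp add: cis_mult)
  finally show ?thesis
    using scaled_edge[OF assms] by simp
qed

lemma side_next_glued_to_side_prev:
  assumes "cos \<alpha> \<noteq> 0"
  shows "(\<lambda>z. z + (rot \<alpha> (k + 1) - rot \<alpha> k) * of_real (e * l)) ` side_next \<alpha> l k e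
           = side_prev \<alpha> l (k + 1) e"
proof -
  define d where "d = (rot \<alpha> (k + 1) - rot \<alpha> k) * of_real (e * l)"
  have "rot \<alpha> k * (apex \<alpha> l - of_real l) = rot \<alpha> (k + 1) * (- apex \<alpha> l - of_real l)"
    unfolding rot_Suc by (subst apex_rot[OF assms]) (simp add: algebra_simps)
  then have "of_real e * (rot \<alpha> k * (apex \<alpha> l - of_real l))
      = of_real e * (rot \<alpha> (k + 1) * (- apex \<alpha> l - of_real l))" by simp
  then have b: "d + rot \<alpha> k * (of_real e * apex \<alpha> l) = rot \<alpha> (k + 1) * (- (of_real e * apex \<alpha> l))"
    by (simp add: d_def algebra_simps)
  have a: "d + rot \<alpha> k * of_real (e * l) = rot \<alpha> (k + 1) * of_real (e * l)"
    by (simp add: d_def algebra_simps)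
  have "(\<lambda>z. z + d) ` side_next \<alpha> l k e = (+) d ` side_next \<alpha> l k e"
    by (simp add: add.commute)
  also have "\<dots> = side_prev \<alpha> l (k + 1) e"
    unfolding side_next_def side_prev_def open_segment_translation[symmetric] a b ..
  finally show ?thesis by (simp add: d_def)
qed


section \<open>View in the triangle\<close>

text \<open>Rotating the \<open>k\<close>-th copy back to the rhombus and folding along the two legs. This is
  compatible with the gluing, and the velocity obeys the mirror law when a side is crossed:
  a straight line in the surface becomes a billiard path in the triangle.\<close>

definition to_triangle :: "real \<Rightarrow> int \<times> complex \<Rightarrow> complex" where
  "to_triangle \<alpha> P = (case P of (k, z) \<Rightarrow> Complex \<bar>Re (z / rot \<alpha> k)\<bar> \<bar>Im (z / rot \<alpha> k)\<bar>)"

lemma to_triangle_glue_next: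
  assumes "cos \<alpha> \<noteq> 0" "glue_next \<alpha> l P Q"
  shows "to_triangle \<alpha> P = to_triangle \<alpha> Q"
proof -
  from assms(2) obtain k z e where P: "P = (k, z)" and z: "z \<in> side_next \<alpha> l k e"
    and Q: "Q = (k + 1, z + (rot \<alpha> (k + 1) - rot \<alpha> k) * of_real (e * l))"
    unfolding glue_next_def by blast
  from z obtain s where s: "z = (1 - s) *\<^sub>R (rot \<alpha> k * of_real (e * l))
      + s *\<^sub>R (rot \<alpha> k * (of_real e * apex \<alpha> l))"
    by (auto simp: side_next_def in_segment)
  have nz: "rot \<alpha> j \<noteq> 0" for j by (simp add: rot_def)
  have "rot \<alpha> k * (apex \<alpha> l - of_real l) = rot \<alpha> (k + 1) * (- apex \<alpha> l - of_real l)"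
    unfolding rot_Suc by (subst apex_rot[OF assms(1)]) (simp add: algebra_simps)
  then have "of_real (s * e) * (rot \<alpha> k * (apex \<alpha> l - of_real l))
      = of_real (s * e) * (rot \<alpha> (k + 1) * (- apex \<alpha> l - of_real l))" by simp
  then have w: "z + (rot \<alpha> (k + 1) - rot \<alpha> k) * of_real (e * l)
      = rot \<alpha> (k + 1) * (of_real (e * (1 - s) * l) - of_real (s * e) * apex \<alpha> l)"
    by (simp add: s scaleR_conv_of_real algebra_simps)
  have z': "z = rot \<alpha> k * (of_real (e * (1 - s) * l) + of_real (s * e) * apex \<alpha> l)"
    by (simp add: s scaleR_conv_of_real algebra_simps)
  have "to_triangle \<alpha> P = Complex \<bar>e * (1 - s) * l\<bar> \<bar>s * e * (l * tan \<alpha>)\<bar>"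
    unfolding P to_triangle_def z' prod.case nonzero_mult_div_cancel_left[OF nz]
    by (simp add: apex_def)
  moreover have "to_triangle \<alpha> Q = Complex \<bar>e * (1 - s) * l\<bar> \<bar>s * e * (l * tan \<alpha>)\<bar>"
    unfolding Q to_triangle_def w prod.case nonzero_mult_div_cancel_left[OF nz]
    by (simp add: apex_def)
  ultimately show ?thesis by simp
qed

text \<open>Reflecting \<open>v\<close> in a line of direction angle \<open>- \<alpha>\<close> (that of the hypotenuse) gives
  \<open>cis (- 2 * \<alpha>) * cnj v\<close>; the remaining \<open>cnj\<close> disappears when folding along the legs.\<close>

lemma mirror_law: "d / rot \<alpha> (k + 1) = cnj (cis (- 2 * \<alpha>) * cnj (d / rot \<alpha> k))"
proof -
  have "cis (- 2 * \<alpha>) * cis (2 * \<alpha>) = 1"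
    by (simp add: cis_mult)
  then have "1 / cis (- 2 * \<alpha>) = cis (2 * \<alpha>)"
    by (simp add: divide_eq_eq mult.commute)
  then have "d / rot \<alpha> (k + 1) = cis (2 * \<alpha>) * (d / rot \<alpha> k)"
    unfolding rot_Suc by (metis mult.commute times_divide_times_eq mult_1_right)
  then show ?thesis
    by (simp add: cis_cnj)
qed


section \<open>Trajectories and codes\<close>

text \<open>\<open>cross \<alpha> l d (k, z) (k', z')\<close>: the straight line entering (or starting in) the \<open>k\<close>-th copy at
  \<open>z\<close> in direction \<open>d\<close> leaves it through the relative interior of a side and enters the copy \<open>k'\<close>
  at \<open>z'\<close>. As vertices are not glued to anything, a trajectory reaching a vertex has no successor;
  nothing happens at the centre.\<close>

definition cross :: "real \<Rightarrow> real \<Rightarrow> complex \<Rightarrow> int \<times> complex \<Rightarrow> int \<times> complex \<Rightarrow> bool" where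
  "cross \<alpha> l d P Q \<longleftrightarrow> (\<exists>t>0. (\<forall>s. 0 < s \<and> s < t \<longrightarrow>
       snd P + of_real s * d \<in> interior (rhombus_copy \<alpha> l (fst P))) \<and>
     glued \<alpha> l (fst P, snd P + of_real t * d) Q)"

text \<open>A nonsingular trajectory is given by its starting point \<open>\<gamma> 0\<close> and the points \<open>\<gamma> n\<close>
  (\<open>n \<ge> 1\<close>) at which it enters the successive rhombi; its code is \<open>fst \<circ> \<gamma>\<close>.\<close>

definition trajectory :: "real \<Rightarrow> real \<Rightarrow> complex \<Rightarrow> int \<times> complex \<Rightarrow> (nat \<Rightarrow> int \<times> complex) \<Rightarrow> bool" where
  "trajectory \<alpha> l d P \<gamma> \<longleftrightarrow> \<gamma> 0 = P \<and> (\<forall>n. cross \<alpha> l d (\<gamma> n) (\<gamma> (Suc n)))"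

definition code :: "(nat \<Rightarrow> int \<times> complex) \<Rightarrow> nat \<Rightarrow> int" where
  "code \<gamma> n = fst (\<gamma> n)"

definition passes :: "real \<Rightarrow> real \<Rightarrow> complex \<Rightarrow> (nat \<Rightarrow> int \<times> complex) \<Rightarrow> nat \<Rightarrow> complex \<Rightarrow> bool" where
  "passes \<alpha> l d \<gamma> n w \<longleftrightarrow>
     w \<in> rhombus_copy \<alpha> l (code \<gamma> n) \<and> (\<exists>s\<ge>0. w = snd (\<gamma> n) + of_real s * d)"

text \<open>The direction of a straight line in the surface is constant, so returning to the starting
  point (here: an interior point of a rhombus) means closing up.\<close>

definition returns :: "real \<Rightarrow> real \<Rightarrow> complex \<Rightarrow> (nat \<Rightarrow> int \<times> complex) \<Rightarrow> nat \<Rightarrow> bool" where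
  "returns \<alpha> l d \<gamma> n \<longleftrightarrow> code \<gamma> n = code \<gamma> 0 \<and> passes \<alpha> l d \<gamma> n (snd (\<gamma> 0))"

definition periodic :: "real \<Rightarrow> real \<Rightarrow> complex \<Rightarrow> (nat \<Rightarrow> int \<times> complex) \<Rightarrow> bool" where
  "periodic \<alpha> l d \<gamma> \<longleftrightarrow> (\<exists>n>0. returns \<alpha> l d \<gamma> n)"

definition period :: "real \<Rightarrow> real \<Rightarrow> complex \<Rightarrow> (nat \<Rightarrow> int \<times> complex) \<Rightarrow> nat" where
  "period \<alpha> l d \<gamma> = (LEAST n. n > 0 \<and> returns \<alpha> l d \<gamma> n)"


section \<open>Perpendicular periodic beams\<close>

definition perp_trajectory :: "real \<Rightarrow> real \<Rightarrow> real \<Rightarrow> (nat \<Rightarrow> int \<times> complex) \<Rightarrow> bool" where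
  "perp_trajectory \<alpha> l x \<gamma> \<longleftrightarrow> trajectory \<alpha> l \<i> (0, of_real x) \<gamma>"

definition perp_strip :: "real \<Rightarrow> real \<Rightarrow> real \<Rightarrow> real \<Rightarrow> (nat \<Rightarrow> int) \<Rightarrow> bool" where
  "perp_strip \<alpha> l u v a \<longleftrightarrow> - l \<le> u \<and> u < v \<and> v \<le> l \<and>
     (\<forall>x\<in>{u<..<v}. \<exists>\<gamma>. perp_trajectory \<alpha> l x \<gamma> \<and> periodic \<alpha> l \<i> \<gamma> \<and> code \<gamma> = a)"

definition perp_periodic_beam :: "real \<Rightarrow> real \<Rightarrow> real \<Rightarrow> real \<Rightarrow> (nat \<Rightarrow> int) \<Rightarrow> bool" where
  "perp_periodic_beam \<alpha> l u v a \<longleftrightarrow> perp_strip \<alpha> l u v a \<and>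
     (\<forall>u' v' a'. perp_strip \<alpha> l u' v' a' \<and> {u<..<v} \<subseteq> {u'<..<v'} \<longrightarrow> u' = u \<and> v' = v)"

definition beam_period :: "real \<Rightarrow> real \<Rightarrow> real \<Rightarrow> real \<Rightarrow> nat \<Rightarrow> bool" where
  "beam_period \<alpha> l u v n \<longleftrightarrow>
     (\<forall>x\<in>{u<..<v}. \<forall>\<gamma>. perp_trajectory \<alpha> l x \<gamma> \<longrightarrow> period \<alpha> l \<i> \<gamma> = n)"

text \<open>The vertical line through the centre reaches the apex, so a beam lies on one side of the
  centre and its interval is mapped injectively into the horizontal leg by \<^const>\<open>to_triangle\<close>.\<close>

lemma rot_0 [simp]: "rot \<alpha> 0 = 1"
  by (simp add: rot_def)

lemma glued_off_axis:
  assumes "l > 0" "cos \<alpha> \<noteq> 0" "glued \<alpha> l (0, z) Q"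
  shows "Re z \<noteq> 0"
proof (rule ccontr)
  assume "\<not> Re z \<noteq> 0"
  then have r: "Re z = 0" by simp
  consider "glue_next \<alpha> l (0, z) Q" | "glue_next \<alpha> l Q (0, z)"
    using assms(3) by (auto simp: glued_def)
  then show False
  proof cases
    case 1
    then obtain e :: real where e: "e \<in> {1, -1}" and z: "z \<in> side_next \<alpha> l 0 e"
      unfolding glue_next_def by blast
    from z r e assms(1) show False
      by (auto simp: side_next_def in_segment apex_def)
  next
    case 2
    then obtain k w e where e: "e \<in> {1, -1::real}" and w: "w \<in> side_next \<alpha> l k e"
      and k: "k + 1 = 0" and z: "z = w + (rot \<alpha> (k + 1) - rot \<alpha> k) * of_real (e * l)"
      unfolding glue_next_def prod.inject by metis
    from assms(2) have "z \<in> side_prev \<alpha> l 0 e"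
      using side_next_glued_to_side_prev[of \<alpha> k e l] w z k by auto
    with r e assms(1) show False
      by (auto simp: side_prev_def in_segment apex_def)
  qed
qed

lemma perp_strip_avoids_center:
  assumes "l > 0" "cos \<alpha> \<noteq> 0" "perp_strip \<alpha> l u v a"
  shows "0 \<notin> {u<..<v}"
proof
  assume "0 \<in> {u<..<v}"
  with assms(3) obtain \<gamma> where "perp_trajectory \<alpha> l 0 \<gamma>"
    unfolding perp_strip_def by blast
  then have 0: "\<gamma> 0 = (0, 0)" and c: "cross \<alpha> l \<i> (\<gamma> 0) (\<gamma> (Suc 0))"
    unfolding perp_trajectory_def trajectory_def by (simp, blast)
  from c obtain t where "glued \<alpha> l (0, of_real t * \<i>) (\<gamma> (Suc 0))"
    unfolding cross_def 0 by auto
  from glued_off_axis[OF assms(1,2) this] show False by simp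
qed

end

theory Submission
  imports Defs
begin

text \<open>The vertical flow on the surface is symmetric, up to reversal of time, under the reflection of
  copy \<open>k\<close> onto copy \<open>- k\<close> and under the half turn of every copy. The reflection shows that a periodic
  perpendicular orbit, started at \<open>x\<close>, returns to copy 0 for the first time after half its period; say
  at \<open>- y\<close>. Consider this orbit together with its image under the half turn, and suppose that no
  centre is hit. In every copy they leave finitely many points, an even number of them on each
  glued side: the number in a copy is even by the half turn, and it is the sum of the numbers for two
  consecutive pairs of sides, while far copies are not visited. Hence a vertex always has an
  even number of orbit points to its left. The points with an odd number of orbit points to their left
  form a flow-invariant set which therefore contains no vertex, and in copy 0 the points between \<open>x\<close> and
  \<open>y\<close> belong to it. So all of them have the code of \<open>x\<close>, and by maximality of the beam \<open>y\<close> belongs to its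
  closure. Since \<open>x + y\<close> is constant on the beam, \<open>x \<mapsto> y\<close> is the reflection in its midpoint, and
  the half turn reverses the beam between its start and its first return.\<close>

section \<open>The exchange of windows\<close>

text \<open>A state \<open>(k, X)\<close> stands for a passage through copy \<open>k\<close> along the vertical line with abscissa \<open>X\<close>,
  and \<open>window k k'\<close> for the abscissae at which one leaves copy \<open>k\<close> for copy \<open>k'\<close>. The sides
  between copies \<open>k\<close> and \<open>k + 1\<close> have horizontal width \<open>2 * \<bar>\<phi> k\<bar>\<close>, and \<open>sgn (\<phi> k)\<close> is the index
  \<open>e\<close> of the one through which \<open>k + 1\<close> is entered from \<open>k\<close>.\<close>

locale exchange =
  fixes \<phi> :: "int \<Rightarrow> real"
  assumes nonzero: "\<phi> k \<noteq> 0"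
    and symmetric: "\<phi> (- k - 1) = \<phi> k"
begin

text \<open>For adjacent copies this is the abscissa of the midpoint of the upper side of copy
  \<open>k\<close> that is glued to copy \<open>k'\<close>.\<close>

definition center :: "int \<Rightarrow> int \<Rightarrow> real" where
  "center k k' = (if k < k' then sgn (\<phi> k) * \<phi> (k - 1) else - sgn (\<phi> k') * \<phi> k)"

definition window :: "int \<Rightarrow> int \<Rightarrow> real set" where
  "window k k' = {center k k' - \<bar>\<phi> (min k k')\<bar> <..< center k k' + \<bar>\<phi> (min k k')\<bar>}"

text \<open>The horizontal part of the gluing translation. It is the same both ways: going back uses
  the inverse gluing along the parallel side, and there \<open>e\<close> has the opposite
  sign.\<close>

definition shift :: "int \<Rightarrow> int \<Rightarrow> real" where
  "shift k k' = (let j = min k k' in sgn (\<phi> j) * (\<phi> (j + 1) - \<phi> (j - 1)))"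

definition step :: "int \<times> real \<Rightarrow> int \<times> real \<Rightarrow> bool" where
  "step P Q \<longleftrightarrow> \<bar>fst Q - fst P\<bar> = 1 \<and> snd P \<in> window (fst P) (fst Q) \<and>
     snd Q = snd P + shift (fst P) (fst Q)"

text \<open>The half turn of a copy about its centre; next, the reflection in the horizontal axis,
  which takes copy \<open>k\<close> to copy \<open>- k\<close>. Both turn upward motion into
  downward motion, hence reverse time.\<close>

abbreviation rho :: "int \<times> real \<Rightarrow> int \<times> real" where
  "rho P \<equiv> (fst P, - snd P)"

abbreviation sigma :: "int \<times> real \<Rightarrow> int \<times> real" where
  "sigma P \<equiv> (- fst P, snd P)"

lemma adjacent_cases:
  assumes "\<bar>k' - k\<bar> = (1::int)"
  obtains "k' = k + 1" | "k = k' + 1"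
  using assms by linarith

lemma shift_commute: "shift k k' = shift k' k"
  by (simp add: shift_def min.commute)

lemma center_flip:
  assumes "\<bar>k' - k\<bar> = 1"
  shows "center k' k = - (center k k' + shift k k')"
  using assms by (cases rule: adjacent_cases) (auto simp: center_def shift_def algebra_simps)

lemma window_flip:
  assumes "\<bar>k' - k\<bar> = 1"
  shows "- (X + shift k k') \<in> window k' k \<longleftrightarrow> X \<in> window k k'"
  using center_flip[OF assms] by (auto simp: window_def min.commute)

lemma step_rho:
  assumes "step P Q"
  shows "step (rho Q) (rho P)"
proof -
  have "\<bar>fst Q - fst P\<bar> = 1" using assms by (simp add: step_def)
  then show ?thesis
    using assms window_flip[of "fst Q" "fst P" "snd P"]
    by (simp add: step_def shift_commute[of "fst Q"] abs_minus_commute)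
qed

lemma reflect:
  assumes "\<bar>k' - k\<bar> = 1"
  shows "shift (- k') (- k) = - shift k k'"
    and "center (- k') (- k) = center k k' + shift k k'"
    and "\<phi> (min (- k') (- k)) = \<phi> (min k k')"
proof -
  have s: "\<phi> (- k' - 1) = \<phi> k'" "\<phi> (- k - 1) = \<phi> k" "\<phi> (- k') = \<phi> (k' - 1)"
    "\<phi> (- k) = \<phi> (k - 1)" "\<phi> (- k' - 1 - 1) = \<phi> (k' + 1)" "\<phi> (- k - 1 - 1) = \<phi> (k + 1)"
    using symmetric[of k] symmetric[of k'] symmetric[of "k - 1"] symmetric[of "k' - 1"]
      symmetric[of "k + 1"] symmetric[of "k' + 1"] by simp_all
  show "shift (- k') (- k) = - shift k k'" "center (- k') (- k) = center k k' + shift k k'"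
    "\<phi> (min (- k') (- k)) = \<phi> (min k k')"
    using assms s
    by (cases rule: adjacent_cases; simp add: shift_def center_def Let_def right_diff_distrib)+
qed

lemma step_sigma:
  assumes "step P Q"
  shows "step (sigma Q) (sigma P)"
proof -
  have "\<bar>fst Q - fst P\<bar> = 1" using assms by (simp add: step_def)
  from reflect[OF this] assms show ?thesis
    by (simp add: step_def window_def)
qed

lemma window_up:
  "window k (k + 1) = {sgn (\<phi> k) * \<phi> (k - 1) - \<bar>\<phi> k\<bar> <..< sgn (\<phi> k) * \<phi> (k - 1) + \<bar>\<phi> k\<bar>}"
  by (simp add: window_def center_def)

lemma window_down:
  "window k (k - 1) =
     {- sgn (\<phi> (k - 1)) * \<phi> k - \<bar>\<phi> (k - 1)\<bar> <..< - sgn (\<phi> (k - 1)) * \<phi> k + \<bar>\<phi> (k - 1)\<bar>}"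
  by (simp add: window_def center_def)

text \<open>The two upper sides of a copy meet in its top vertex, whose abscissa \<open>V\<close>
  separates the windows. In all four sign cases it is
  \<open>center k (k + 1) + center k (k - 1)\<close>.\<close>

lemma vertex:
  obtains V where "V \<notin> window k (k + 1)" "V \<notin> window k (k - 1)"
    "(\<forall>x\<in>window k (k + 1). x < V) \<and> (\<forall>x\<in>window k (k - 1). V < x) \<or>
     (\<forall>x\<in>window k (k + 1). V < x) \<and> (\<forall>x\<in>window k (k - 1). x < V)"
proof -
  have "\<phi> k > 0 \<or> \<phi> k < 0" "\<phi> (k - 1) > 0 \<or> \<phi> (k - 1) < 0"
    using nonzero[of k] nonzero[of "k - 1"] by linarith+
  then consider "\<phi> k > 0" "\<phi> (k - 1) > 0" | "\<phi> k < 0" "\<phi> (k - 1) < 0"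
    | "\<phi> k > 0" "\<phi> (k - 1) < 0" | "\<phi> k < 0" "\<phi> (k - 1) > 0"
    by blast
  then show thesis
  proof cases
    case 1
    then show ?thesis
      by (intro that[of "\<phi> (k - 1) - \<phi> k"]) (auto simp: window_up window_down)
  next
    case 2
    then show ?thesis
      by (intro that[of "\<phi> k - \<phi> (k - 1)"]) (auto simp: window_up window_down)
  next
    case 3
    then show ?thesis
      by (intro that[of "\<phi> k + \<phi> (k - 1)"]) (auto simp: window_up window_down)
  next
    case 4
    then show ?thesis
      by (intro that[of "- \<phi> k - \<phi> (k - 1)"]) (auto simp: window_up window_down)
  qed
qed

lemma windows_disjoint: "window k (k + 1) \<inter> window k (k - 1) = {}"
  by (rule vertex[of k]) force

lemma neighbours:
  assumes "\<bar>k' - k\<bar> = (1::int)" "\<bar>k'' - k\<bar> = 1" "k' \<noteq> k''"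
  shows "k' = k + 1 \<and> k'' = k - 1 \<or> k' = k - 1 \<and> k'' = k + 1"
  using assms by linarith

lemma window_unique:
  assumes "\<bar>k' - k\<bar> = 1" "\<bar>k'' - k\<bar> = 1" "X \<in> window k k'" "X \<in> window k k''"
  shows "k' = k''"
  using neighbours[OF assms(1,2)] windows_disjoint[of k] assms(3,4) by blast

lemma step_deterministic:
  assumes "step P Q" "step P Q'"
  shows "Q = Q'"
  using assms window_unique[of "fst Q" "fst P" "fst Q'" "snd P"]
  by (auto simp: step_def prod_eq_iff)

text \<open>The half turn conjugates the flow to its inverse, so determinism gives
  injectivity.\<close>

lemma step_injective:
  assumes "step P Q" "step P' Q"
  shows "P = P'"
  using step_deterministic[OF step_rho[OF assms(1)] step_rho[OF assms(2)]]
  by (auto simp: prod_eq_iff)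

lemma path_unique:
  assumes "\<And>n. n < N \<Longrightarrow> step (P n) (P (Suc n))" "\<And>n. n < N \<Longrightarrow> step (Q n) (Q (Suc n))"
    and "P 0 = Q 0" "n \<le> N"
  shows "P n = Q n"
  using assms(4)
proof (induction n)
  case (Suc n)
  then show ?case using assms(1,2)[of n] step_deterministic by simp
qed (use assms in simp)

end

lemma even_card_symmetric:
  fixes S :: "real set"
  assumes "finite S" "\<And>x. x \<in> S \<Longrightarrow> - x \<in> S" "0 \<notin> S"
  shows "even (card S)"
proof -
  have "S = {x \<in> S. x > 0} \<union> uminus ` {x \<in> S. x > 0}"
  proof (intro equalityI subsetI)
    fix x assume x: "x \<in> S"
    with assms(3) have "x \<noteq> 0" by metis
    then consider "x > 0" | "- x > 0" by linarith
    then show "x \<in> {x \<in> S. x > 0} \<union> uminus ` {x \<in> S. x > 0}"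
      using x assms(2)[OF x] by cases (auto intro!: image_eqI[of _ _ "- x"])
  qed (use assms(2) in auto)
  moreover have "card ({x \<in> S. x > 0} \<union> uminus ` {x \<in> S. x > 0})
      = card {x \<in> S. x > 0} + card (uminus ` {x \<in> S. x > 0})"
    by (intro card_Un_disjoint) (use assms(1) in auto)
  ultimately show ?thesis by (simp add: card_image)
qed

text \<open>Absorbs the reversal of order caused by the half turn: in an even set the side of
  \<open>Z\<close> on which one counts does not matter.\<close>

lemma even_complement:
  fixes S :: "real set"
  assumes "finite S" "even (card S)" "Z \<notin> S"
  shows "odd (card {X \<in> S. Z < X}) \<longleftrightarrow> odd (card {X \<in> S. X < Z})"
proof -
  have "card S = card ({X \<in> S. Z < X} \<union> {X \<in> S. X < Z})"
    using assms(3) by (intro arg_cong[where f = card]) (auto simp: not_less order_le_less)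
  also have "\<dots> = card {X \<in> S. Z < X} + card {X \<in> S. X < Z}"
    using assms(1) by (intro card_Un_disjoint) auto
  finally show ?thesis using assms(2) by simp
qed


section \<open>Parity\<close>

text \<open>To be applied to a periodic orbit together with its half turn. As no centre is hit, the
  points in each copy fall into pairs \<open>X\<close>, \<open>- X\<close>.\<close>

locale symmetric_orbits = exchange +
  fixes \<O> :: "(int \<times> real) set"
  assumes finite_orbits: "finite \<O>"
    and forward: "P \<in> \<O> \<Longrightarrow> \<exists>Q\<in>\<O>. step P Q"
    and rho_closed: "P \<in> \<O> \<Longrightarrow> rho P \<in> \<O>"
    and off_center: "(k, 0) \<notin> \<O>"
begin

definition fibre :: "int \<Rightarrow> real set" where
  "fibre k = {X. (k, X) \<in> \<O>}"

definition odd_below :: "int \<Rightarrow> real \<Rightarrow> bool" where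
  "odd_below k Z \<longleftrightarrow> odd (card {X \<in> fibre k. X < Z})"

lemma finite_fibre [simp]: "finite (fibre k)"
proof -
  have "fibre k \<subseteq> snd ` \<O>" by (force simp: fibre_def)
  then show ?thesis using finite_orbits by (meson finite_imageI finite_subset)
qed

lemma uminus_fibre: "- X \<in> fibre k \<longleftrightarrow> X \<in> fibre k"
  using rho_closed[of "(k, X)"] rho_closed[of "(k, - X)"] by (auto simp: fibre_def)

lemma even_card_fibre: "even (card (fibre k))"
  by (rule even_card_symmetric) (auto simp: uminus_fibre, simp add: fibre_def off_center)

lemma step_closed: "P \<in> \<O> \<Longrightarrow> step P Q \<Longrightarrow> Q \<in> \<O>"
  using forward step_deterministic by blast

lemma fibre_flip:
  assumes "\<bar>k' - k\<bar> = 1" "X \<in> fibre k \<inter> window k k'"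
  shows "- (X + shift k k') \<in> fibre k' \<inter> window k' k"
proof -
  have "step (k, X) (k', X + shift k k')"
    using assms by (auto simp: step_def)
  then have "X + shift k k' \<in> fibre k'"
    using assms(2) step_closed by (auto simp: fibre_def)
  then show ?thesis
    using assms window_flip by (metis IntD2 IntI uminus_fibre)
qed

text \<open>Crossing the side and then making the half turn injects the orbit points of one window
  into the other; this works in both directions.\<close>

lemma card_flip_le:
  assumes "\<bar>k' - k\<bar> = 1"
  shows "card (fibre k \<inter> window k k') \<le> card (fibre k' \<inter> window k' k)"
  by (rule card_inj_on_le[of "\<lambda>X. - (X + shift k k')"])
    (use fibre_flip[OF assms] in \<open>auto simp: inj_on_def\<close>)

lemma card_flip:
  assumes "\<bar>k' - k\<bar> = 1"
  shows "card (fibre k \<inter> window k k') = card (fibre k' \<inter> window k' k)"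
  using card_flip_le[of k k'] card_flip_le[of k' k] assms by (simp add: abs_minus_commute)

lemma fibre_split: "fibre k = (fibre k \<inter> window k (k + 1)) \<union> (fibre k \<inter> window k (k - 1))"
proof -
  have "X \<in> window k (k + 1) \<or> X \<in> window k (k - 1)" if X: "X \<in> fibre k" for X
  proof -
    obtain k' X' where "step (k, X) (k', X')"
      using forward[of "(k, X)"] X by (auto simp: fibre_def)
    then have "\<bar>k' - k\<bar> = 1" "X \<in> window k k'" by (auto simp: step_def)
    then show ?thesis by (cases rule: adjacent_cases) auto
  qed
  then show ?thesis by blast
qed

lemma card_fibre_split:
  "card {X \<in> fibre k. Q X}
     = card {X \<in> fibre k \<inter> window k (k + 1). Q X} + card {X \<in> fibre k \<inter> window k (k - 1). Q X}"
proof -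
  have "{X \<in> fibre k. Q X}
      = {X \<in> fibre k \<inter> window k (k + 1). Q X} \<union> {X \<in> fibre k \<inter> window k (k - 1). Q X}"
    using fibre_split[of k] by blast
  moreover have "{X \<in> fibre k \<inter> window k (k + 1). Q X} \<inter> {X \<in> fibre k \<inter> window k (k - 1). Q X} = {}"
    using windows_disjoint[of k] by blast
  ultimately show ?thesis by (simp add: card_Un_disjoint)
qed

text \<open>Descending induction: beyond the highest visited copy there are no points, and evenness
  passes down because each whole fibre is even.\<close>

lemma even_card_window_up: "even (card (fibre k \<inter> window k (k + 1)))"
proof -
  have "finite (fst ` \<O>)" using finite_orbits by simp
  then obtain N where N: "\<And>k. k \<in> fst ` \<O> \<Longrightarrow> k \<le> N"
    by (meson bdd_above_def bdd_above_finite)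
  have big: "fibre k = {}" if "k > N" for k
    using N[of k] that by (force simp: fibre_def)
  show ?thesis
  proof (cases "k \<le> N + 1")
    case True
    then show ?thesis
    proof (induction k rule: int_le_induct)
      case base
      show ?case using big[of "N + 1"] by simp
    next
      case (step i)
      have "card (fibre i) = card (fibre i \<inter> window i (i + 1)) + card (fibre i \<inter> window i (i - 1))"
        using card_fibre_split[of i "\<lambda>_. True"] by (simp add: Collect_conj_eq)
      moreover have "card (fibre i \<inter> window i (i - 1)) = card (fibre (i - 1) \<inter> window (i - 1) i)"
        by (rule card_flip) simp
      ultimately show ?case
        using step.IH even_card_fibre[of i] by simp
    qed
  qed (use big[of k] in simp)
qed

lemma even_card_window:
  assumes "\<bar>k' - k\<bar> = 1"
  shows "even (card (fibre k \<inter> window k k'))"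
  using assms
proof (cases rule: adjacent_cases)
  case 1
  then show ?thesis using even_card_window_up by simp
next
  case 2
  then show ?thesis using even_card_window_up[of k'] card_flip[OF assms] by simp
qed

text \<open>A point outside a window has all or none of the window below it, hence an even number
  of points of that window.\<close>

lemma even_below_outside:
  assumes "\<bar>k' - k\<bar> = 1" "Z \<notin> window k k'"
  shows "even (card {X \<in> fibre k \<inter> window k k'. X < Z})"
proof -
  have "{X \<in> fibre k \<inter> window k k'. X < Z} = {} \<or>
        {X \<in> fibre k \<inter> window k k'. X < Z} = fibre k \<inter> window k k'"
  proof (cases "Z < center k k'")
    case True
    with assms(2) have "\<forall>X\<in>window k k'. Z \<le> X" by (auto simp: window_def)
    then show ?thesis by (force simp: not_less)
  next
    case False
    with assms(2) have "\<forall>X\<in>window k k'. X < Z" by (auto simp: window_def)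
    then show ?thesis by blast
  qed
  then show ?thesis using even_card_window[OF assms(1)] by (metis card.empty even_zero)
qed

text \<open>A window that misses \<open>Z\<close> contributes an even number. In particular no
  vertex is an odd point.\<close>

lemma odd_below_imp_window:
  assumes "odd_below k Z"
  shows "Z \<in> window k (k + 1) \<or> Z \<in> window k (k - 1)"
  using assms even_below_outside[of "k + 1" k Z] even_below_outside[of "k - 1" k Z]
  unfolding odd_below_def card_fibre_split[of k "\<lambda>X. X < Z"] by (simp, blast)

text \<open>The other window contributes an even number, so the parity is read off in the window
  that moves on.\<close>

lemma odd_below_in_window:
  assumes "\<bar>k' - k\<bar> = 1" "Z \<in> window k k'"
  shows "odd_below k Z \<longleftrightarrow> odd (card {X \<in> fibre k \<inter> window k k'. X < Z})"
proof -
  have k': "k' = k + 1 \<or> k' = k - 1" using assms(1) by linarith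
  then show ?thesis
  proof
    assume "k' = k + 1"
    moreover from this have "Z \<notin> window k (k - 1)" using windows_disjoint[of k] assms(2) by blast
    ultimately show ?thesis
      using even_below_outside[of "k - 1" k Z]
      unfolding odd_below_def card_fibre_split[of k "\<lambda>X. X < Z"] by simp
  next
    assume "k' = k - 1"
    moreover from this have "Z \<notin> window k (k + 1)" using windows_disjoint[of k] assms(2) by blast
    ultimately show ?thesis
      using even_below_outside[of "k + 1" k Z]
      unfolding odd_below_def card_fibre_split[of k "\<lambda>X. X < Z"] by simp
  qed
qed

lemma odd_below_uminus:
  assumes "Z \<notin> fibre k"
  shows "odd_below k (- Z) \<longleftrightarrow> odd_below k Z"
proof -
  have "{X \<in> fibre k. X < - Z} = uminus ` {X \<in> fibre k. Z < X}"
  proof (intro equalityI subsetI)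
    fix X assume "X \<in> {X \<in> fibre k. X < - Z}"
    then show "X \<in> uminus ` {X \<in> fibre k. Z < X}"
      by (intro image_eqI[of _ _ "- X"]) (auto simp: uminus_fibre)
  qed (auto simp: uminus_fibre)
  then have "card {X \<in> fibre k. X < - Z} = card {X \<in> fibre k. Z < X}"
    by (simp add: card_image)
  then show ?thesis
    using even_complement[OF finite_fibre even_card_fibre assms] by (simp add: odd_below_def)
qed

text \<open>The odd set is invariant under the flow. Crossing followed by the half turn reverses
  order, so points to the right of \<open>Z\<close> become points to the left; as windows and fibres
  are even, changing sides keeps the parity.\<close>

lemma odd_below_transport:
  assumes adj: "\<bar>k' - k\<bar> = 1" and Z: "Z \<in> window k k'" "Z \<notin> fibre k" "odd_below k Z"
  shows "Z + shift k k' \<notin> fibre k'" "odd_below k' (Z + shift k k')"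
proof -
  define g where "g X = - (X + shift k k')" for X
  have adj': "\<bar>k - k'\<bar> = 1" using adj by simp
  have gg: "- (g X + shift k' k) = X" for X
    by (simp add: g_def shift_commute[of k'])
  have gZ: "g Z \<in> window k' k" using window_flip[OF adj] Z(1) by (simp add: g_def)
  show notin: "Z + shift k k' \<notin> fibre k'"
  proof
    assume "Z + shift k k' \<in> fibre k'"
    then have "g Z \<in> fibre k' \<inter> window k' k"
      using gZ uminus_fibre by (simp add: g_def del: minus_add_distrib)
    from fibre_flip[OF adj' this] show False using Z(2) gg by simp
  qed
  have "{X \<in> fibre k' \<inter> window k' k. X < g Z} = g ` {X \<in> fibre k \<inter> window k k'. Z < X}"
  proof (intro equalityI subsetI)
    fix X assume X: "X \<in> {X \<in> fibre k' \<inter> window k' k. X < g Z}"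
    then have "- (X + shift k' k) \<in> fibre k \<inter> window k k'" using fibre_flip[OF adj'] by blast
    with X show "X \<in> g ` {X \<in> fibre k \<inter> window k k'. Z < X}"
      by (intro image_eqI[of _ _ "- (X + shift k' k)"]) (auto simp: g_def shift_commute[of k'])
  next
    fix X assume "X \<in> g ` {X \<in> fibre k \<inter> window k k'. Z < X}"
    then show "X \<in> {X \<in> fibre k' \<inter> window k' k. X < g Z}"
      using fibre_flip[OF adj] by (auto simp: g_def)
  qed
  moreover have "inj g" by (auto simp: inj_def g_def)
  ultimately have "card {X \<in> fibre k' \<inter> window k' k. X < g Z} = card {X \<in> fibre k \<inter> window k k'. Z < X}"
    by (simp add: card_image inj_on_subset[of g UNIV])
  then have "odd_below k' (g Z)"
    using odd_below_in_window[OF adj' gZ] odd_below_in_window[OF adj Z(1)] Z(2,3)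
      even_complement[OF _ even_card_window[OF adj], of Z] by simp
  then show "odd_below k' (Z + shift k k')"
    using odd_below_uminus[OF notin] by (simp add: g_def)
qed

text \<open>The segment contains no orbit point except \<open>x\<close>, so the count is the same at
  \<open>Y\<close> and at \<open>Z\<close>.\<close>

lemma odd_below_segment:
  assumes "x \<in> fibre k" "odd_below k Z" "fibre k \<inter> closed_segment x Z \<subseteq> {x}"
    and Y: "Y \<in> closed_segment x Z" "Y \<noteq> x"
  shows "odd_below k Y"
proof -
  have "{X \<in> fibre k. X < Y} = {X \<in> fibre k. X < Z}"
    using assms(1,3) Y by (force simp: closed_segment_eq_real_ivl split: if_splits)
  then show ?thesis using assms(2) by (simp add: odd_below_def)
qed

text \<open>A vertex between \<open>x\<close> and \<open>Z\<close> would be an odd point, so both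
  leave through the same side. The last four conclusions restore the hypotheses in the next copy, so
  the step can be iterated.\<close>

lemma strip_step:
  assumes step: "step (k, x) (k', x')"
    and x: "x \<in> fibre k" and Z: "Z \<notin> fibre k" "odd_below k Z"
    and seg: "fibre k \<inter> closed_segment x Z \<subseteq> {x}"
  defines "Z' \<equiv> Z + shift k k'"
  shows "step (k, Z) (k', Z')" "x' \<in> fibre k'" "Z' \<notin> fibre k'" "odd_below k' Z'"
    "fibre k' \<inter> closed_segment x' Z' \<subseteq> {x'}"
proof -
  have adj: "\<bar>k' - k\<bar> = 1" and xw: "x \<in> window k k'" and x': "x' = x + shift k k'"
    using step by (auto simp: step_def)
  have adj': "\<bar>k - k'\<bar> = 1" using adj by simp
  have Zw: "Z \<in> window k k'"
  proof (rule ccontr)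
    assume "Z \<notin> window k k'"
    obtain V where V: "V \<notin> window k (k + 1)" "V \<notin> window k (k - 1)"
      "(\<forall>x\<in>window k (k + 1). x < V) \<and> (\<forall>x\<in>window k (k - 1). V < x) \<or>
       (\<forall>x\<in>window k (k + 1). V < x) \<and> (\<forall>x\<in>window k (k - 1). x < V)"
      by (rule vertex)
    have "k' = k + 1 \<or> k' = k - 1" using adj by linarith
    \<comment> \<open>If the exit sides differed, the vertex where they meet would lie strictly
      between \<open>x\<close> and \<open>Z\<close>.\<close>
    then have "x < V \<and> V < Z \<or> Z < V \<and> V < x"
      using V(3) xw \<open>Z \<notin> window k k'\<close> odd_below_imp_window[OF Z(2)] by auto
    then have "V \<in> closed_segment x Z" "V \<noteq> x"
      by (auto simp: closed_segment_eq_real_ivl)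
    from odd_below_imp_window[OF odd_below_segment[OF x Z(2) seg this]] V(1,2)
    show False by simp
  qed
  show "step (k, Z) (k', Z')" using adj Zw by (simp add: step_def Z'_def)
  show "x' \<in> fibre k'" using step_closed[OF _ step] x by (simp add: fibre_def)
  show "Z' \<notin> fibre k'" "odd_below k' Z'"
    unfolding Z'_def using odd_below_transport[OF adj Zw Z] by auto
  show "fibre k' \<inter> closed_segment x' Z' \<subseteq> {x'}"
  proof
    fix X assume X: "X \<in> fibre k' \<inter> closed_segment x' Z'"
    \<comment> \<open>By convexity the whole strip lies in one window, so an orbit point in the new
      strip can be pulled back to the old one.\<close>
    define Y where "Y = X - shift k k'"
    have Y: "Y \<in> closed_segment x Z"
      using X by (auto simp: Y_def Z'_def x' closed_segment_eq_real_ivl split: if_splits)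
    moreover have "convex (window k k')" by (simp add: window_def)
    ultimately have "Y \<in> window k k'"
      using xw Zw by (meson closed_segment_subset subsetD)
    then have "- X \<in> window k' k"
      using window_flip[OF adj, of Y] by (simp add: Y_def)
    then have "- (- X + shift k' k) \<in> fibre k"
      using fibre_flip[OF adj', of "- X"] X uminus_fibre by auto
    then have "Y \<in> fibre k" by (simp add: Y_def shift_commute[of k'])
    with Y seg have "Y = x" by blast
    then show "X \<in> {x'}" by (simp add: Y_def x')
  qed
qed

end

section \<open>Perpendicular orbits\<close>

context exchange
begin

text \<open>Along a vertical line the abscissa changes only by gluing, so the code alone determines
  the change, and one sum serves every starting point of a beam.\<close>

definition displacement :: "(nat \<Rightarrow> int) \<Rightarrow> nat \<Rightarrow> real" where
  "displacement a n = (\<Sum>i<n. shift (a i) (a (Suc i)))"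

definition follows :: "(nat \<Rightarrow> int) \<Rightarrow> real \<Rightarrow> bool" where
  "follows a x \<longleftrightarrow>
     (\<forall>n. step (a n, x + displacement a n) (a (Suc n), x + displacement a (Suc n)))"

lemma displacement_0 [simp]: "displacement a 0 = 0"
  by (simp add: displacement_def)

lemma displacement_Suc: "displacement a (Suc n) = displacement a n + shift (a n) (a (Suc n))"
  by (simp add: displacement_def)

lemma followsI:
  assumes "\<And>n. step (P n) (P (Suc n))" "\<And>n. fst (P n) = a n"
  shows "follows a (snd (P 0))" "\<And>n. snd (P n) = snd (P 0) + displacement a n"
proof -
  show d: "snd (P n) = snd (P 0) + displacement a n" for n
  proof (induction n)
    case (Suc n)
    then show ?case using assms(1)[of n] by (simp add: step_def displacement_Suc assms(2))
  qed simp
  have P: "P n = (a n, snd (P 0) + displacement a n)" for n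
    using d[of n] assms(2)[of n] by (simp add: prod_eq_iff)
  show "follows a (snd (P 0))"
    unfolding follows_def P[symmetric] using assms(1) by blast
qed

lemma follows_adjacent: "follows a x \<Longrightarrow> \<bar>a (Suc n) - a n\<bar> = 1"
  by (auto simp: follows_def step_def)

lemma follows_parity: "follows a x \<Longrightarrow> even (a n - a 0 - int n)"
proof (induction n)
  case (Suc n)
  have "odd (a (Suc n) - a n)"
    using follows_adjacent[OF Suc.prems, of n] by (metis dvd_abs_iff odd_one)
  moreover have "even (a n - a 0 - int n)" using Suc by blast
  ultimately show ?case by (auto split: if_splits)
qed simp

lemma follows_unique:
  assumes "follows a x" "follows b x" "a 0 = b 0"
  shows "a = b"
proof
  fix n
  have "(a n, x + displacement a n) = (b n, x + displacement b n)"
    by (rule path_unique[where N = n]) (use assms in \<open>auto simp: follows_def\<close>)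
  then show "a n = b n" by simp
qed

text \<open>Since \<open>\<phi> (- 1) = \<phi> 0\<close>, the top vertex of copy 0 lies above its
  centre.\<close>

lemma window_zero:
  assumes "\<bar>j\<bar> = 1"
  shows "window 0 j = (if j = 1 then {0 <..< 2 * \<bar>\<phi> 0\<bar>} else {- 2 * \<bar>\<phi> 0\<bar> <..< 0})"
proof -
  have "j = 1 \<or> j = - 1" using assms by linarith
  moreover have "\<phi> (- 1) = \<phi> 0" using symmetric[of 0] by simp
  ultimately show ?thesis
    by (auto simp: window_def center_def mult_sgn_abs abs_mult_sgn mult.commute sgn_if)
qed

end

section \<open>A closed perpendicular orbit and its first return to copy 0\<close>

locale perpendicular_orbit = exchange +
  fixes a :: "nat \<Rightarrow> int" and x :: real and p :: nat
  assumes follows: "follows a x"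
    and start: "a 0 = 0"
    and p_pos: "p > 0"
    and closes: "a (2 * p) = 0" "displacement a (2 * p) = 0"
    and minimal: "0 < n \<Longrightarrow> n < 2 * p \<Longrightarrow> a n = 0 \<Longrightarrow> displacement a n \<noteq> 0"
begin

definition pos :: "nat \<Rightarrow> int \<times> real" where
  "pos n = (a n, x + displacement a n)"

lemma step_pos: "step (pos n) (pos (Suc n))"
  using follows by (simp add: follows_def pos_def)

lemma pos_0: "pos 0 = (0, x)"
  by (simp add: pos_def start)

lemma pos_period: "pos (2 * p) = pos 0"
  by (simp add: pos_def start closes)

lemma pos_minimal: "0 < n \<Longrightarrow> n < 2 * p \<Longrightarrow> pos n \<noteq> pos 0"
  using minimal by (auto simp: pos_def start)

text \<open>\<open>sigma\<close> fixes the initial state, which is also the state at time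
  \<open>2 * p\<close>. So the orbit run backwards and reflected has the same start, and coincides
  with the orbit.\<close>

lemma pos_reflected:
  assumes "n \<le> 2 * p"
  shows "pos n = sigma (pos (2 * p - n))"
proof (rule path_unique[where N = "2 * p" and P = pos and Q = "\<lambda>n. sigma (pos (2 * p - n))"])
  fix n assume n: "n < 2 * p"
  show "step (pos n) (pos (Suc n))" by (rule step_pos)
  have "2 * p - n = Suc (2 * p - Suc n)" using n by simp
  then show "step (sigma (pos (2 * p - n))) (sigma (pos (2 * p - Suc n)))"
    using step_sigma[OF step_pos] by metis
qed (use assms pos_period in \<open>auto simp: pos_0\<close>)

text \<open>The middle time is its own mirror image, so its label equals its negative.\<close>

lemma half_period: "a p = 0"
  using pos_reflected[of p] by (simp add: pos_def)

lemma pos_add_period: "pos (n + 2 * p) = pos n"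
  by (rule path_unique[where N = n]) (use step_pos pos_period in simp_all)

lemma pos_mod: "pos n = pos (n mod (2 * p))"
proof (induction n rule: less_induct)
  case (less n)
  show ?case
  proof (cases "n < 2 * p")
    case False
    then have "pos n = pos (n - 2 * p)" using pos_add_period[of "n - 2 * p"] by simp
    also have "\<dots> = pos ((n - 2 * p) mod (2 * p))" using less[of "n - 2 * p"] False p_pos by simp
    also have "(n - 2 * p) mod (2 * p) = n mod (2 * p)" using False by (simp add: le_mod_geq)
    finally show ?thesis .
  qed simp
qed

lemma pos_cancel: "pos (n + m) = pos n \<Longrightarrow> pos m = pos 0"
proof (induction n)
  case (Suc n)
  have "pos (n + m) = pos n"
    using step_injective[of "pos (n + m)" "pos (Suc n)" "pos n"] step_pos[of "n + m"] step_pos[of n]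
      Suc.prems by simp
  then show ?case by (rule Suc.IH)
qed simp

text \<open>Inside copy 0 the reflection in the horizontal diagonal fixes every orbit point,
  so a visit at time \<open>n\<close> forces the states at times \<open>n\<close> and \<open>2 * p - n\<close> to agree.\<close>

lemma visits_zero:
  assumes "n < 2 * p" "a n = 0"
  shows "n = 0 \<or> n = p"
proof (rule ccontr)
  assume neg: "\<not> (n = 0 \<or> n = p)"
  have eq: "pos n = pos (2 * p - n)"
    using pos_reflected[of n] assms by (auto simp: pos_def)
  show False
  \<comment> \<open>Either way the two equal states are a positive time less than
    \<open>2 * p\<close> apart, against minimality.\<close>
  proof (cases "n < p")
    case True
    have "pos (n + (2 * p - 2 * n)) = pos n" using eq True by (simp add: algebra_simps)
    from pos_cancel[OF this] pos_minimal[of "2 * p - 2 * n"] True neg show False by simp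
  next
    case False
    have "pos ((2 * p - n) + (2 * n - 2 * p)) = pos (2 * p - n)"
      using eq False neg assms by (simp add: algebra_simps)
    moreover have "0 < 2 * n - 2 * p" "2 * n - 2 * p < 2 * p" using False neg assms by linarith+
    ultimately show False using pos_cancel pos_minimal by blast
  qed
qed

lemma first_label: "\<bar>a 1\<bar> = 1"
  using follows_adjacent[OF follows, of 0] start by simp

text \<open>Labels change by one and avoid 0 before time \<open>p\<close>, so they cannot change
  sign.\<close>

lemma same_side:
  assumes "0 < n" "n < p"
  shows "a n * a 1 > 0"
  using assms
proof (induction n)
  case (Suc n)
  have a1: "a 1 = 1 \<or> a 1 = - 1" using first_label by linarith
  show ?case
  proof (cases "n = 0")
    case True
    then show ?thesis using a1 by auto
  next
    case False
    have "a (Suc n) \<noteq> 0" using visits_zero[of "Suc n"] Suc.prems by auto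
    moreover have "a n * a 1 > 0" using Suc False by simp
    ultimately show ?thesis
      using follows_adjacent[OF follows, of n] a1 by (auto simp: zero_less_mult_iff)
  qed
qed simp

lemma start_window: "x \<in> window 0 (a 1)"
  using step_pos[of 0] by (simp add: step_def pos_def start)

text \<open>The half turn is applied to the first return to bring it to the same side of the centre
  as \<open>x\<close>.\<close>

definition y :: real where
  "y = - (x + displacement a p)"

text \<open>By \<open>same_side\<close> the orbit comes back from the copy it first went to; the
  half turn makes its last step before the return a first step from \<open>y\<close> into that
  copy.\<close>

lemma return_window: "y \<in> window 0 (a 1)"
proof -
  have "p \<noteq> 1" using half_period first_label by auto
  then have p: "p = Suc (p - 1)" "0 < p - 1" using p_pos by auto
  have adj: "\<bar>a p - a (p - 1)\<bar> = 1" using follows_adjacent[OF follows, of "p - 1"] p by simp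
  have "a (p - 1) * a 1 > 0" using same_side[of "p - 1"] p by simp
  then have a: "a (p - 1) = a 1"
    using adj half_period first_label by (auto simp: abs_if zero_less_mult_iff split: if_splits)
  have "step (pos (p - 1)) (pos p)" using step_pos[of "p - 1"] p by simp
  then have "step (rho (pos p)) (rho (pos (p - 1)))" by (rule step_rho)
  then have "- (x + displacement a p) \<in> window 0 (a (p - 1))"
    by (simp add: step_def pos_def half_period)
  then show ?thesis by (simp only: a y_def)
qed

definition orbits :: "(int \<times> real) set" where
  "orbits = {P. \<exists>n. P = pos n \<or> P = rho (pos n)}"

lemma finite_range_pos: "finite (range pos)"
proof -
  have "range pos \<subseteq> pos ` {..<2 * p}"
    using pos_mod p_pos by (force intro!: image_eqI[where x = "_ mod (2 * p)"])
  then show ?thesis by (meson finite_imageI finite_lessThan finite_subset)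
qed

lemma orbits_zero: "(0, X) \<in> orbits \<longleftrightarrow> X \<in> {x, - x, y, - y}"
proof
  assume "(0, X) \<in> orbits"
  then obtain n where n: "(0, X) = pos n \<or> (0, X) = rho (pos n)" by (auto simp: orbits_def)
  define r where "r = n mod (2 * p)"
  have r: "(0, X) = pos r \<or> (0, X) = rho (pos r)" "r < 2 * p"
    using n pos_mod[of n] p_pos by (simp_all add: r_def)
  then have "a r = 0" by (auto simp: pos_def)
  with visits_zero r have "r = 0 \<or> r = p" by blast
  with r show "X \<in> {x, - x, y, - y}" by (auto simp: pos_def y_def)
next
  have "pos 0 = (0, x)" "pos p = (0, - y)" by (simp_all add: pos_def start half_period y_def)
  then have "(0, x) = pos 0" "(0, - x) = rho (pos 0)" "(0, y) = rho (pos p)" "(0, - y) = pos p"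
    by simp_all
  moreover assume "X \<in> {x, - x, y, - y}"
  ultimately show "(0, X) \<in> orbits" by (auto simp: orbits_def)
qed

text \<open>A point strictly between \<open>x\<close> and \<open>y\<close> is odd and no orbit point
  separates it from \<open>x\<close>; \<open>strip_step\<close> then keeps it alongside the orbit of
  \<open>x\<close> forever.\<close>

lemma follows_between:
  assumes generic: "\<And>n. x + displacement a n \<noteq> 0"
    and Z: "min x y < Z" "Z < max x y"
  shows "follows a Z"
proof -
  interpret symmetric_orbits \<phi> orbits
  proof
    have "orbits = range pos \<union> rho ` range pos" by (auto simp: orbits_def)
    then show "finite orbits" using finite_range_pos by simp
    show "rho P \<in> orbits" if "P \<in> orbits" for P
      using that by (auto simp: orbits_def)
    show "(k, 0) \<notin> orbits" for k
      using generic by (auto simp: orbits_def pos_def) (metis add.right_inverse)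
    fix P assume "P \<in> orbits"
    then consider n where "P = pos n" | n where "P = rho (pos n)" by (auto simp: orbits_def)
    then show "\<exists>Q\<in>orbits. step P Q"
    proof cases
      case 1
      then show ?thesis using step_pos[of n] unfolding orbits_def by blast
    next
      case 2
      \<comment> \<open>The successor of \<open>rho (pos n)\<close> is the half turn of the
        predecessor of \<open>pos n\<close>, taken one period later to cover
        \<open>n = 0\<close>.\<close>
      have "step (pos (n + 2 * p - 1)) (pos n)"
        using step_pos[of "n + 2 * p - 1"] p_pos pos_add_period[of n] by simp
      from step_rho[OF this] 2 show ?thesis unfolding orbits_def by blast
    qed
  qed
  have signs: "x > 0 \<and> y > 0 \<or> x < 0 \<and> y < 0"
    using start_window return_window window_zero[OF first_label] by (auto split: if_splits)
  have fib: "fibre 0 = {x, - x, y, - y}" by (auto simp: fibre_def orbits_zero)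
  \<comment> \<open>On the positive side \<open>- x\<close>, \<open>- y\<close> and the smaller of
    \<open>x\<close> and \<open>y\<close> lie to the left of \<open>Z\<close>; on the negative side
    only the smaller one does.\<close>
  have "odd_below 0 Z"
    using signs
  proof
    assume pos: "x > 0 \<and> y > 0"
    then have "{X \<in> fibre 0. X < Z} = {- x, - y, min x y}"
      using Z by (auto simp: fib min_def max_def split: if_splits)
    moreover have "card {- x, - y, min x y} = 3"
      using pos Z by (auto simp: card_insert_if min_def)
    ultimately show ?thesis by (simp add: odd_below_def)
  next
    assume neg: "x < 0 \<and> y < 0"
    then have "{X \<in> fibre 0. X < Z} = {min x y}"
      using Z by (auto simp: fib min_def max_def split: if_splits)
    then show ?thesis by (simp add: odd_below_def)
  qed
  then have base: "x \<in> fibre 0" "Z \<notin> fibre 0" "odd_below 0 Z" "fibre 0 \<inter> closed_segment x Z \<subseteq> {x}"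
    using Z signs by (auto simp: fib closed_segment_eq_real_ivl split: if_splits)
  have inv: "x + displacement a n \<in> fibre (a n) \<and> Z + displacement a n \<notin> fibre (a n) \<and>
      odd_below (a n) (Z + displacement a n) \<and>
      fibre (a n) \<inter> closed_segment (x + displacement a n) (Z + displacement a n) \<subseteq> {x + displacement a n}" for n
  proof (induction n)
    case 0
    then show ?case using base start by simp
  next
    case (Suc n)
    then show ?case
      using strip_step[of "a n" "x + displacement a n" "a (Suc n)" "x + displacement a (Suc n)"
          "Z + displacement a n"] step_pos[of n]
      by (simp add: pos_def displacement_Suc add.assoc)
  qed
  show ?thesis
    unfolding follows_def
  proof
    fix n
    show "step (a n, Z + displacement a n) (a (Suc n), Z + displacement a (Suc n))"
      using strip_step(1)[of "a n" "x + displacement a n" "a (Suc n)" "x + displacement a (Suc n)"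
          "Z + displacement a n"] step_pos[of n] inv[of n]
      by (simp add: pos_def displacement_Suc add.assoc)
  qed
qed

text \<open>The half turn reverses the orbit from \<open>x\<close> to its first return and makes it start at \<open>y\<close>.\<close>

lemma reversed_orbit:
  assumes "follows a y" "n \<le> p"
  shows "a (p - n) = a n" "x + displacement a (p - n) = - (y + displacement a n)"
proof -
  have "(a n, y + displacement a n) = rho (pos (p - n))"
  proof (rule path_unique[where N = p and P = "\<lambda>n. (a n, y + displacement a n)"
        and Q = "\<lambda>n. rho (pos (p - n))"])
    fix n assume n: "n < p"
    show "step (a n, y + displacement a n) (a (Suc n), y + displacement a (Suc n))"
      using assms(1) by (simp add: follows_def)
    have "p - n = Suc (p - Suc n)" using n by simp
    then show "step (rho (pos (p - n))) (rho (pos (p - Suc n)))"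
      using step_rho[OF step_pos] by metis
  qed (use assms in \<open>auto simp: pos_def start half_period y_def\<close>)
  then show "a (p - n) = a n" "x + displacement a (p - n) = - (y + displacement a n)"
    by (auto simp: pos_def)
qed

end

section \<open>Unfolded trajectories\<close>

text \<open>Irrationality of \<alpha> enters as \<open>no_vertical_side\<close>: upward motion is
  never parallel to a side.\<close>

locale right_triangle =
  fixes \<alpha> l :: real
  assumes l_pos: "l > 0" and \<alpha>_pos: "0 < \<alpha>" and \<alpha>_less: "\<alpha> < pi / 2"
    and no_vertical_side: "cos ((2 * of_int k + 1) * \<alpha>) \<noteq> 0"
begin

text \<open>\<open>coord k\<close> is \<open>1\<close> and \<open>- 1\<close> on the two sides glued to copy \<open>k + 1\<close>, and \<open>coord (k - 1)\<close> is
  \<open>- 1\<close> and \<open>1\<close> on those glued to copy \<open>k - 1\<close>. The second statement holds because gluing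
  translates the common side of copies \<open>k - 1\<close> and \<open>k\<close> to the opposite one.\<close>

definition coord :: "int \<Rightarrow> complex \<Rightarrow> real" where
  "coord k w = (Re w * sin ((2 * of_int k + 1) * \<alpha>) + Im w * cos ((2 * of_int k + 1) * \<alpha>)) / (l * sin \<alpha>)"

definition slope :: "int \<Rightarrow> real" where
  "slope k = cos ((2 * of_int k + 1) * \<alpha>) / (l * sin \<alpha>)"

text \<open>A side has length \<open>l / cos \<alpha>\<close> and direction angle
  \<open>- (2 * k + 1) * \<alpha>\<close>; this is half its horizontal extent, with a sign telling
  which of the two parallel sides is the upper one.\<close>

definition half_width :: "int \<Rightarrow> real" where
  "half_width k = l * cos ((2 * of_int k + 1) * \<alpha>) / (2 * cos \<alpha>)"

lemma trig_pos: "sin \<alpha> > 0" "cos \<alpha> > 0" "tan \<alpha> > 0"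
  using \<alpha>_pos \<alpha>_less by (simp_all add: sin_gt_zero cos_gt_zero tan_gt_zero)

sublocale exchange half_width
proof
  fix k :: int
  show "half_width k \<noteq> 0"
    using no_vertical_side[of k] l_pos trig_pos by (simp add: half_width_def)
  have "(2 * of_int (- k - 1) + 1) * \<alpha> = - ((2 * of_int k + 1) * \<alpha>)"
    by (simp add: algebra_simps)
  then show "half_width (- k - 1) = half_width k"
    unfolding half_width_def by (metis cos_minus)
qed

lemma slope_nonzero: "slope k \<noteq> 0"
  using no_vertical_side[of k] l_pos trig_pos by (simp add: slope_def)

lemma sgn_slope: "sgn (slope k) = sgn (half_width k)"
  using l_pos trig_pos by (simp add: slope_def half_width_def sgn_mult sgn_divide)

lemma half_width_0: "half_width 0 = l / 2"
  using trig_pos by (simp add: half_width_def)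

lemma coord_add: "coord k (v + w) = coord k v + coord k w"
  by (simp add: coord_def add_divide_distrib algebra_simps)

lemma coord_diff: "coord k (v - w) = coord k v - coord k w"
  by (simp add: coord_def diff_divide_distrib add_divide_distrib algebra_simps)

lemma coord_scale: "coord k (of_real c * w) = c * coord k w"
  by (simp add: coord_def algebra_simps)

lemma coord_up: "coord k (w + of_real s * \<i>) = coord k w + s * slope k"
  by (simp add: coord_def slope_def add_divide_distrib algebra_simps)

lemma coord_rot: "coord k (rot \<alpha> j * w) = coord (k - j) w"
proof -
  have A: "(2 * of_int (k - j) + 1) * \<alpha> = (2 * of_int k + 1) * \<alpha> - 2 * \<alpha> * of_int j"
    by (simp add: algebra_simps)
  show ?thesis
    unfolding coord_def A sin_diff cos_diff by (simp add: rot_def algebra_simps)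
qed

lemma coord_corners:
  "coord 0 (of_real l) = 1" "coord (- 1) (of_real l) = - 1"
  "coord 0 (apex \<alpha> l) = 1" "coord (- 1) (apex \<alpha> l) = 1"
  using l_pos trig_pos by (simp_all add: coord_def apex_def tan_def)

text \<open>Cramer's rule for \<open>coord k\<close> and \<open>coord (k - 1)\<close>; up to scaling
  the determinant is \<open>sin (2 * \<alpha>)\<close>.\<close>

lemma Re_coord: "Re w = coord k w * half_width (k - 1) - coord (k - 1) w * half_width k"
proof -
  define A B where "A = (2 * of_int k + 1) * \<alpha>" and "B = (2 * of_int (k - 1) + 1) * \<alpha>"
  have "A - B = 2 * \<alpha>" by (simp add: A_def B_def algebra_simps)
  then have "sin A * cos B - cos A * sin B = 2 * sin \<alpha> * cos \<alpha>"
    by (simp add: sin_diff[symmetric] sin_double)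
  then have "Re w * (2 * sin \<alpha> * cos \<alpha>) = Re w * (sin A * cos B - cos A * sin B)" by simp
  then have "Re w * (2 * sin \<alpha> * cos \<alpha>) =
      (Re w * sin A + Im w * cos A) * cos B - (Re w * sin B + Im w * cos B) * cos A"
    by (simp add: algebra_simps)
  then have "Re w = ((Re w * sin A + Im w * cos A) * cos B - (Re w * sin B + Im w * cos B) * cos A)
      / (2 * sin \<alpha> * cos \<alpha>)"
    using trig_pos by (simp add: field_simps)
  also have "\<dots> = coord k w * half_width (k - 1) - coord (k - 1) w * half_width k"
    unfolding coord_def half_width_def A_def[symmetric] B_def[symmetric]
    using l_pos trig_pos by (simp add: field_simps)
  finally show ?thesis .
qed

lemma coord_eqI:
  assumes "coord k v = coord k w" "coord (k - 1) v = coord (k - 1) w"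
  shows "v = w"
proof -
  have "Re v = Re w" using Re_coord[of v k] Re_coord[of w k] assms by simp
  moreover from this have "Im v = Im w"
    using assms(1) no_vertical_side[of k] l_pos trig_pos by (simp add: coord_def)
  ultimately show ?thesis by (simp add: complex_eq_iff)
qed

lemma coord_surj: "\<exists>w. coord k w = A \<and> coord (k - 1) w = B"
proof
  define c d w where "c = (A - B) / 2" and "d = (A + B) / 2"
    and "w = rot \<alpha> k * (of_real c * of_real l + of_real d * apex \<alpha> l)"
  have "coord j w = c * coord (j - k) (of_real l) + d * coord (j - k) (apex \<alpha> l)" for j
    by (simp only: w_def coord_rot coord_add coord_scale)
  from this[of k] this[of "k - 1"] have "coord k w = c + d" "coord (k - 1) w = d - c"
    by (simp_all add: coord_corners)
  then show "coord k w = A \<and> coord (k - 1) w = B"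
    by (simp add: c_def d_def field_simps)
qed

section \<open>The rhombus and its gluing in side coordinates\<close>

lemma triangle_iff: "z \<in> triangle \<alpha> l \<longleftrightarrow> 0 \<le> Re z \<and> 0 \<le> Im z \<and> Re z / l + Im z / (l * tan \<alpha>) \<le> 1"
proof
  assume "z \<in> triangle \<alpha> l"
  then obtain r s t where rst: "0 \<le> r" "0 \<le> s" "0 \<le> t" "r + s + t = 1"
    and z: "z = r *\<^sub>R 0 + s *\<^sub>R of_real l + t *\<^sub>R apex \<alpha> l"
    by (auto simp: triangle_def convex_hull_3)
  have "Re z = s * l" "Im z = t * (l * tan \<alpha>)" by (simp_all add: z apex_def)
  with rst l_pos trig_pos show "0 \<le> Re z \<and> 0 \<le> Im z \<and> Re z / l + Im z / (l * tan \<alpha>) \<le> 1"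
    by simp
next
  assume z: "0 \<le> Re z \<and> 0 \<le> Im z \<and> Re z / l + Im z / (l * tan \<alpha>) \<le> 1"
  define s t where "s = Re z / l" and "t = Im z / (l * tan \<alpha>)"
  have "z = (1 - s - t) *\<^sub>R 0 + s *\<^sub>R of_real l + t *\<^sub>R apex \<alpha> l"
    using l_pos trig_pos by (simp add: complex_eq_iff s_def t_def apex_def)
  moreover have "0 \<le> s" "0 \<le> t" "0 \<le> 1 - s - t"
    using z l_pos trig_pos by (simp_all add: s_def t_def)
  ultimately show "z \<in> triangle \<alpha> l"
    unfolding triangle_def convex_hull_3
    by (intro CollectI exI[of _ "1 - s - t"] exI[of _ s] exI[of _ t]) simp
qed

text \<open>In units of the half diagonals the rhombus is
  \<open>\<bar>X\<bar> + \<bar>Y\<bar> \<le> 1\<close>, which is a square in the coordinates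
  \<open>X + Y\<close> and \<open>- X + Y\<close>.\<close>

lemma rhombus_iff: "z \<in> rhombus \<alpha> l \<longleftrightarrow> \<bar>coord 0 z\<bar> \<le> 1 \<and> \<bar>coord (- 1) z\<bar> \<le> 1"
proof -
  define X Y where "X = Re z / l" and "Y = Im z / (l * tan \<alpha>)"
  have sg: "0 \<le> Re z \<longleftrightarrow> 0 \<le> X" "0 \<le> Im z \<longleftrightarrow> 0 \<le> Y" "Re z \<le> 0 \<longleftrightarrow> X \<le> 0" "Im z \<le> 0 \<longleftrightarrow> Y \<le> 0"
    using l_pos trig_pos
    by (simp_all add: X_def Y_def zero_le_divide_iff divide_le_0_iff mult_le_0_iff zero_le_mult_iff)
  have "z \<in> cnj ` triangle \<alpha> l \<longleftrightarrow> cnj z \<in> triangle \<alpha> l"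
    by (metis complex_cnj_cnj image_iff)
  moreover have "z \<in> uminus ` triangle \<alpha> l \<longleftrightarrow> - z \<in> triangle \<alpha> l"
    by (metis add.inverse_inverse image_iff)
  moreover have "z \<in> (\<lambda>z. - cnj z) ` triangle \<alpha> l \<longleftrightarrow> - cnj z \<in> triangle \<alpha> l"
    by (metis (no_types, lifting) add.inverse_inverse complex_cnj_cnj complex_cnj_minus image_iff)
  ultimately have "z \<in> rhombus \<alpha> l \<longleftrightarrow> 0 \<le> X \<and> 0 \<le> Y \<and> X + Y \<le> 1 \<or> 0 \<le> X \<and> Y \<le> 0 \<and> X - Y \<le> 1
      \<or> X \<le> 0 \<and> 0 \<le> Y \<and> - X + Y \<le> 1 \<or> X \<le> 0 \<and> Y \<le> 0 \<and> - X - Y \<le> 1"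
    unfolding rhombus_def Un_iff by (simp add: triangle_iff sg flip: X_def Y_def)
  also have "\<dots> \<longleftrightarrow> \<bar>X + Y\<bar> \<le> 1 \<and> \<bar>- X + Y\<bar> \<le> 1"
    by (cases "0 \<le> X"; cases "0 \<le> Y") auto
  also have "X + Y = coord 0 z"
    using l_pos trig_pos by (simp add: X_def Y_def coord_def tan_def field_simps)
  also have "- X + Y = coord (- 1) z"
    using l_pos trig_pos by (simp add: X_def Y_def coord_def tan_def field_simps)
  finally show ?thesis .
qed

lemma rhombus_copy_iff: "w \<in> rhombus_copy \<alpha> l k \<longleftrightarrow> \<bar>coord k w\<bar> \<le> 1 \<and> \<bar>coord (k - 1) w\<bar> \<le> 1"
proof -
  have nz: "rot \<alpha> k \<noteq> 0" by (simp add: rot_def)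
  have c: "coord k (rot \<alpha> k * z) = coord 0 z" "coord (k - 1) (rot \<alpha> k * z) = coord (- 1) z" for z
    by (simp_all add: coord_rot)
  have w: "w = rot \<alpha> k * (w / rot \<alpha> k)" using nz by simp
  have "w \<in> rhombus_copy \<alpha> l k \<longleftrightarrow> w / rot \<alpha> k \<in> rhombus \<alpha> l"
    unfolding rhombus_copy_def using w nz by (metis (no_types, lifting) image_iff nonzero_mult_div_cancel_left)
  then show ?thesis
    using c[of "w / rot \<alpha> k"] w by (simp add: rhombus_iff)
qed

lemma interior_rhombus_copyI:
  assumes "\<bar>coord k w\<bar> < 1" "\<bar>coord (k - 1) w\<bar> < 1"
  shows "w \<in> interior (rhombus_copy \<alpha> l k)"
proof (rule interiorI)
  show "open {w. \<bar>coord k w\<bar> < 1 \<and> \<bar>coord (k - 1) w\<bar> < 1}"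
    unfolding coord_def divide_inverse by (intro open_Collect_conj open_Collect_less continuous_intros)
qed (use assms in \<open>auto simp: rhombus_copy_iff\<close>)

lemma side_next_iff:
  assumes e: "e \<in> {1, - 1}"
  shows "z \<in> side_next \<alpha> l k e \<longleftrightarrow> coord k z = e \<and> \<bar>coord (k - 1) z\<bar> < 1"
proof -
  define P Q where "P = rot \<alpha> k * of_real (e * l)" and "Q = rot \<alpha> k * (of_real e * apex \<alpha> l)"
  have c: "coord k P = e" "coord (k - 1) P = - e" "coord k Q = e" "coord (k - 1) Q = e"
    by (simp_all add: P_def Q_def coord_rot coord_scale coord_corners)
  then have PQ: "P \<noteq> Q" using e by force
  have lin: "coord j ((1 - s) *\<^sub>R P + s *\<^sub>R Q) = (1 - s) * coord j P + s * coord j Q" for j s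
    by (simp add: scaleR_conv_of_real coord_add coord_scale del: of_real_diff)
  show ?thesis
  proof
    assume "z \<in> side_next \<alpha> l k e"
    then obtain s where "0 < s" "s < 1" "z = (1 - s) *\<^sub>R P + s *\<^sub>R Q"
      by (auto simp: side_next_def in_segment P_def Q_def)
    then have "coord k z = e" "coord (k - 1) z = (2 * s - 1) * e"
      by (simp_all only: lin c) (simp_all add: algebra_simps)
    with e \<open>0 < s\<close> \<open>s < 1\<close> show "coord k z = e \<and> \<bar>coord (k - 1) z\<bar> < 1"
      by auto
  next
    assume z: "coord k z = e \<and> \<bar>coord (k - 1) z\<bar> < 1"
    \<comment> \<open>Along the side \<open>coord (k - 1)\<close> runs affinely from
      \<open>- e\<close> to \<open>e\<close>; this solves for the parameter.\<close>
    define s where "s = (1 + e * coord (k - 1) z) / 2"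
    have ee: "e * e = 1" using e by auto
    have "z = (1 - s) *\<^sub>R P + s *\<^sub>R Q"
    proof (rule coord_eqI[of k])
      show "coord k z = coord k ((1 - s) *\<^sub>R P + s *\<^sub>R Q)"
        unfolding lin c using z by (simp add: algebra_simps)
      have "(1 - s) * - e + s * e = (2 * s - 1) * e" by (simp add: algebra_simps)
      also have "\<dots> = (e * e) * coord (k - 1) z" by (simp add: s_def field_simps)
      finally show "coord (k - 1) z = coord (k - 1) ((1 - s) *\<^sub>R P + s *\<^sub>R Q)"
        unfolding lin c by (simp add: ee)
    qed
    moreover have "0 < s" "s < 1" using z e by (auto simp: s_def)
    ultimately show "z \<in> side_next \<alpha> l k e"
      unfolding side_next_def P_def[symmetric] Q_def[symmetric] in_segment using PQ by blast
  qed
qed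

text \<open>The translation takes a side to the opposite one, so \<open>coord k\<close> changes
  sign; the other coordinate is found by comparing abscissae before and after it through
  \<open>Re_coord\<close>.\<close>

lemma glue_next_iff:
  "glue_next \<alpha> l (k, z) (k', z') \<longleftrightarrow> k' = k + 1 \<and> \<bar>coord k z\<bar> = 1 \<and> \<bar>coord (k - 1) z\<bar> < 1 \<and>
     coord k z' = - coord k z \<and> coord (k + 1) z' = - coord (k - 1) z"
proof -
  have shifted: "coord k (z + (rot \<alpha> (k + 1) - rot \<alpha> k) * of_real (e * l)) = - coord k z \<and>
      coord (k + 1) (z + (rot \<alpha> (k + 1) - rot \<alpha> k) * of_real (e * l)) = - coord (k - 1) z"
    if e: "coord k z = e" for e
  proof -
    define P P' where "P = rot \<alpha> k * of_real (e * l)" and "P' = rot \<alpha> (k + 1) * of_real (e * l)"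
    have d: "z + (rot \<alpha> (k + 1) - rot \<alpha> k) * of_real (e * l) = z + (P' - P)"
      by (simp add: P_def P'_def algebra_simps)
    have c: "coord k P = e" "coord (k - 1) P = - e" "coord (k + 1) P' = e" "coord k P' = - e"
      by (simp_all add: P_def P'_def coord_rot coord_scale coord_corners)
    have k: "coord k (z + (P' - P)) = - e"
      by (simp add: coord_add coord_diff c e)
    have "coord (k + 1) (z + (P' - P)) * half_width k + e * half_width (k + 1)
        = Re z + Re P' - Re P"
      using Re_coord[of "z + (P' - P)" "k + 1"] k by simp
    also have "\<dots> = - coord (k - 1) z * half_width k + e * half_width (k + 1)"
      using Re_coord[of z k] Re_coord[of P k] Re_coord[of P' "k + 1"] c e by (simp add: algebra_simps)
    finally have "(coord (k + 1) (z + (P' - P)) + coord (k - 1) z) * half_width k = 0"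
      by (simp add: distrib_right)
    then have "coord (k + 1) (z + (P' - P)) = - coord (k - 1) z"
      using nonzero[of k] by simp
    with k show ?thesis unfolding d e by blast
  qed
  show ?thesis
  proof
    assume "glue_next \<alpha> l (k, z) (k', z')"
    then obtain e where "e \<in> {1, - 1}" "z \<in> side_next \<alpha> l k e" "k' = k + 1"
      "z' = z + (rot \<alpha> (k + 1) - rot \<alpha> k) * of_real (e * l)"
      unfolding glue_next_def by blast
    with shifted[of e] side_next_iff[of e z k]
    show "k' = k + 1 \<and> \<bar>coord k z\<bar> = 1 \<and> \<bar>coord (k - 1) z\<bar> < 1 \<and>
      coord k z' = - coord k z \<and> coord (k + 1) z' = - coord (k - 1) z" by auto
  next
    assume *: "k' = k + 1 \<and> \<bar>coord k z\<bar> = 1 \<and> \<bar>coord (k - 1) z\<bar> < 1 \<and>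
      coord k z' = - coord k z \<and> coord (k + 1) z' = - coord (k - 1) z"
    define e where "e = coord k z"
    have e: "e \<in> {1, - 1}" using * by (auto simp: e_def)
    have "z' = z + (rot \<alpha> (k + 1) - rot \<alpha> k) * of_real (e * l)"
      by (rule coord_eqI[of "k + 1"]) (use * shifted[of e] in \<open>auto simp: e_def\<close>)
    moreover have "z \<in> side_next \<alpha> l k e" using side_next_iff[OF e] * by (simp add: e_def)
    ultimately show "glue_next \<alpha> l (k, z) (k', z')"
      unfolding glue_next_def using * e by blast
  qed
qed

section \<open>Crossing a rhombus upwards\<close>

lemma window_up_iff:
  assumes "coord k w = sgn (half_width k)"
  shows "Re w \<in> window k (k + 1) \<longleftrightarrow> \<bar>coord (k - 1) w\<bar> < 1"
proof -
  have "Re w \<in> window k (k + 1) \<longleftrightarrow> \<bar>Re w - sgn (half_width k) * half_width (k - 1)\<bar> < \<bar>half_width k\<bar>"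
    by (auto simp: window_up abs_less_iff)
  also have "Re w - sgn (half_width k) * half_width (k - 1) = - coord (k - 1) w * half_width k"
    using Re_coord[of w k] assms by simp
  also have "\<bar>\<dots>\<bar> < \<bar>half_width k\<bar> \<longleftrightarrow> \<bar>coord (k - 1) w\<bar> < 1"
    using nonzero[of k] by (simp add: abs_mult)
  finally show ?thesis .
qed

lemma window_down_iff:
  assumes "coord (k - 1) w = sgn (half_width (k - 1))"
  shows "Re w \<in> window k (k - 1) \<longleftrightarrow> \<bar>coord k w\<bar> < 1"
proof -
  have "Re w \<in> window k (k - 1) \<longleftrightarrow>
      \<bar>Re w + sgn (half_width (k - 1)) * half_width k\<bar> < \<bar>half_width (k - 1)\<bar>"
    by (auto simp: window_down abs_less_iff)
  also have "Re w + sgn (half_width (k - 1)) * half_width k = coord k w * half_width (k - 1)"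
    using Re_coord[of w k] assms by simp
  also have "\<bar>\<dots>\<bar> < \<bar>half_width (k - 1)\<bar> \<longleftrightarrow> \<bar>coord k w\<bar> < 1"
    using nonzero[of "k - 1"] by (simp add: abs_mult)
  finally show ?thesis .
qed

definition project :: "int \<times> complex \<Rightarrow> int \<times> real" where
  "project P = (fst P, Re (snd P))"

lemma glue_up:
  assumes "glue_next \<alpha> l (k, w) (k', z')" "coord k w = sgn (half_width k)"
  shows "step (k, Re w) (k', Re z')"
proof -
  note g = assms(1)[unfolded glue_next_iff]
  have "Re z' - Re w = sgn (half_width k) * (half_width (k + 1) - half_width (k - 1))"
    using Re_coord[of w k] Re_coord[of z' "k + 1"] g assms(2) by (simp add: algebra_simps)
  then show ?thesis
    using g window_up_iff[OF assms(2)] by (simp add: step_def shift_def)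
qed

lemma glue_down:
  assumes "glue_next \<alpha> l (k', z') (k, w)" "coord (k - 1) w = sgn (half_width (k - 1))"
  shows "step (k, Re w) (k', Re z')"
proof -
  have k': "k' = k - 1" and c: "coord (k - 1) z' = - coord (k - 1) w"
    "coord (k - 2) z' = - coord k w" "\<bar>coord k w\<bar> < 1"
    using assms(1) by (auto simp: glue_next_iff)
  have "Re z' - Re w = sgn (half_width (k - 1)) * (half_width k - half_width (k - 2))"
    using Re_coord[of w k] Re_coord[of z' "k - 1"] c assms(2) by (simp add: algebra_simps)
  then show ?thesis
    using window_down_iff[OF assms(2)] c(3) by (simp add: step_def shift_def k')
qed

text \<open>\<open>coord j\<close> is strictly monotone along upward motion, so a value of modulus 1
  reached at positive time has the sign of the slope.\<close>

lemma exit_side_upper: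
  assumes "\<bar>coord j z\<bar> \<le> 1" "\<bar>coord j (z + of_real t * \<i>)\<bar> = 1" "t > 0"
  shows "coord j (z + of_real t * \<i>) = sgn (half_width j)"
proof -
  have "slope j > 0 \<or> slope j < 0" using slope_nonzero[of j] by linarith
  then show ?thesis
  proof
    assume s: "slope j > 0"
    then have "t * slope j > 0" using assms(3) by simp
    then have "coord j (z + of_real t * \<i>) = 1"
      using assms(1,2) coord_up[of j z t] by linarith
    with s show ?thesis by (simp add: sgn_slope[symmetric])
  next
    assume s: "slope j < 0"
    then have "t * slope j < 0" using assms(3) by (simp add: mult_pos_neg)
    then have "coord j (z + of_real t * \<i>) = - 1"
      using assms(1,2) coord_up[of j z t] by linarith
    with s show ?thesis by (simp add: sgn_slope[symmetric])
  qed
qed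

text \<open>For entry points, which lie on a lower side: all points of the copy on the same vertical
  line are then reached in nonnegative time, as \<open>passes\<close> demands.\<close>

lemma lower_side_lowest:
  assumes "coord j z = - sgn (half_width j)" "\<bar>coord j w\<bar> \<le> 1" "Re w = Re z"
  shows "Im z \<le> Im w"
proof -
  have "w = z + of_real (Im w - Im z) * \<i>" using assms(3) by (simp add: complex_eq_iff)
  then have eq: "coord j w = coord j z + (Im w - Im z) * slope j" using coord_up by metis
  have "slope j > 0 \<or> slope j < 0" using slope_nonzero[of j] by linarith
  then show ?thesis
  proof
    assume s: "slope j > 0"
    then have "0 \<le> (Im w - Im z) * slope j" using assms eq sgn_slope[of j, symmetric] by simp
    with s show ?thesis by (simp add: zero_le_mult_iff)
  next
    assume s: "slope j < 0"
    then have "(Im w - Im z) * slope j \<le> 0" using assms eq sgn_slope[of j, symmetric] by simp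
    with s show ?thesis by (simp add: mult_le_0_iff)
  qed
qed

lemma cross_step:
  assumes "cross \<alpha> l \<i> P Q"
  shows "step (project P) (project Q)"
    and "w \<in> rhombus_copy \<alpha> l (fst Q) \<Longrightarrow> Re w = Re (snd Q) \<Longrightarrow> Im (snd Q) \<le> Im w"
proof -
  obtain k z k' z' where PQ: "P = (k, z)" "Q = (k', z')" by fastforce
  obtain t where t: "t > 0"
    and inside: "\<And>s. 0 < s \<Longrightarrow> s < t \<Longrightarrow> z + of_real s * \<i> \<in> interior (rhombus_copy \<alpha> l k)"
    and glue: "glued \<alpha> l (k, z + of_real t * \<i>) (k', z')"
    using assms unfolding cross_def PQ by auto
  \<comment> \<open>\<open>cross\<close> puts the points strictly between start and exit into the
    copy, so the argument starts halfway.\<close>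
  define v where "v = z + of_real (t / 2) * \<i>"
  have w: "z + of_real t * \<i> = v + of_real (t / 2) * \<i>"
    by (simp add: v_def complex_eq_iff)
  have "v \<in> rhombus_copy \<alpha> l k"
    using inside[of "t / 2"] t interior_subset by (auto simp: v_def)
  then have v: "\<bar>coord k v\<bar> \<le> 1" "\<bar>coord (k - 1) v\<bar> \<le> 1" by (simp_all add: rhombus_copy_iff)
  define u where "u = z + of_real t * \<i>"
  have u: "u = v + of_real (t / 2) * \<i>" "Re u = Re z"
    using w by (simp only: u_def) (simp add: u_def)
  have "step (k, Re z) (k', Re z') \<and>
    (\<exists>j. (j = k' \<or> j = k' - 1) \<and> coord j z' = - sgn (half_width j))"
    using glue unfolding glued_def u_def[symmetric]
  proof
    assume g: "glue_next \<alpha> l (k, u) (k', z')"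
    then have c: "coord k u = sgn (half_width k)"
      using exit_side_upper[OF v(1), of "t / 2"] t u by (simp add: glue_next_iff)
    have "k' = k + 1 \<and> coord k z' = - sgn (half_width k)"
      using g c by (simp add: glue_next_iff)
    then show ?thesis using glue_up[OF g c] u by auto
  next
    assume g: "glue_next \<alpha> l (k', z') (k, u)"
    then have c: "coord (k - 1) u = sgn (half_width (k - 1))"
      using exit_side_upper[OF v(2), of "t / 2"] t u by (auto simp: glue_next_iff)
    have "k' = k - 1 \<and> coord (k - 1) z' = - sgn (half_width (k - 1))"
      using g c by (auto simp: glue_next_iff)
    then show ?thesis using glue_down[OF g c] u by auto
  qed
  then show "step (project P) (project Q)"
    and "w \<in> rhombus_copy \<alpha> l (fst Q) \<Longrightarrow> Re w = Re (snd Q) \<Longrightarrow> Im (snd Q) \<le> Im w"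
    using lower_side_lowest[of _ z' w] by (auto simp: project_def PQ rhombus_copy_iff)
qed

text \<open>The closed copy without its two upper sides.\<close>

definition below_top :: "int \<Rightarrow> complex \<Rightarrow> bool" where
  "below_top k z \<longleftrightarrow> (\<forall>j\<in>{k, k - 1}. \<bar>coord j z\<bar> \<le> 1 \<and> sgn (half_width j) * coord j z < 1)"

text \<open>\<open>j\<close> names the pair of parallel sides used for the exit and \<open>i\<close>
  the other pair. Before the exit, both coordinates interpolate between their values at
  \<open>z\<close> and at the exit point, which keeps the path interior.\<close>

lemma exit_point:
  assumes z: "below_top k z" and ij: "{i, j} = {k, k - 1}"
  obtains t where "t > 0" "coord j (z + of_real t * \<i>) = sgn (half_width j)"
    "\<bar>coord i (z + of_real t * \<i>)\<bar> < 1 \<Longrightarrow>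
       \<forall>s. 0 < s \<and> s < t \<longrightarrow> z + of_real s * \<i> \<in> interior (rhombus_copy \<alpha> l k)"
proof -
  define t where "t = (sgn (half_width j) - coord j z) / slope j"
  have mem: "i \<in> {k, k - 1}" "j \<in> {k, k - 1}" using ij by blast+
  have j: "\<bar>coord j z\<bar> \<le> 1" "sgn (half_width j) * coord j z < 1" and i: "\<bar>coord i z\<bar> \<le> 1"
    using z mem unfolding below_top_def by blast+
  have sg: "sgn (half_width j) = sgn (slope j)" by (simp add: sgn_slope)
  have t: "t > 0"
    using j slope_nonzero[of j] unfolding t_def sg
    by (cases "slope j > 0") (auto simp: zero_less_divide_iff)
  have cj: "coord j (z + of_real t * \<i>) = sgn (half_width j)"
    using slope_nonzero[of j] unfolding coord_up by (simp add: t_def)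
  moreover have "z + of_real s * \<i> \<in> interior (rhombus_copy \<alpha> l k)"
    if ci: "\<bar>coord i (z + of_real t * \<i>)\<bar> < 1" and s: "0 < s" "s < t" for s
  proof -
    define q where "q = s / t"
    have q: "0 < q" "q < 1" using s by (simp_all add: q_def)
    have conv: "coord m (z + of_real s * \<i>)
        = (1 - q) * coord m z + q * coord m (z + of_real t * \<i>)" for m
      unfolding coord_up using t by (simp add: q_def field_simps)
    have le: "\<bar>(1 - q) * A\<bar> \<le> 1 - q" if "\<bar>A\<bar> \<le> 1" for A
      using that q by (simp add: abs_mult mult_left_le)
    have "\<bar>q * coord i (z + of_real t * \<i>)\<bar> < q"
      using ci q by (simp add: abs_mult)
    then have ci': "\<bar>coord i (z + of_real s * \<i>)\<bar> < 1"
      using le[OF i] unfolding conv by linarith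
    have sgn1: "sgn (half_width j) = 1 \<or> sgn (half_width j) = - 1"
      using nonzero[of j] by (auto simp: sgn_if)
    have lt: "(1 - q) * (sgn (half_width j) * coord j z) < 1 - q"
      using j(2) q by simp
    have "\<bar>(1 - q) * coord j z + q * sgn (half_width j)\<bar> < 1"
      using sgn1
    proof
      assume s: "sgn (half_width j) = 1"
      then have "(1 - q) * coord j z < 1 - q" using lt by simp
      then show ?thesis using le[OF j(1)] q unfolding s by linarith
    next
      assume s: "sgn (half_width j) = - 1"
      then have "- ((1 - q) * coord j z) < 1 - q" using lt by simp
      then show ?thesis using le[OF j(1)] q unfolding s by linarith
    qed
    then have cj': "\<bar>coord j (z + of_real s * \<i>)\<bar> < 1"
      unfolding conv cj .
    show ?thesis
      by (rule interior_rhombus_copyI) (use ci' cj' ij in \<open>auto simp: doubleton_eq_iff\<close>)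
  qed
  ultimately show thesis using t that by blast
qed

lemma below_topI:
  assumes "{i, j} = {k, k - 1}" "\<bar>coord i z\<bar> < 1" "coord j z = - sgn (half_width j)"
  shows "below_top k z"
proof -
  have "sgn (half_width m) = 1 \<or> sgn (half_width m) = - 1" for m
    using nonzero[of m] by (auto simp: sgn_if)
  from this[of i] this[of j]
  have "\<bar>coord i z\<bar> \<le> 1 \<and> sgn (half_width i) * coord i z < 1"
    "\<bar>coord j z\<bar> \<le> 1 \<and> sgn (half_width j) * coord j z < 1"
    using assms(2,3) by auto
  then show ?thesis unfolding below_top_def assms(1)[symmetric] by blast
qed

text \<open>Converse to \<open>cross_step\<close>; keeping \<open>below_top\<close> true lets it be
  iterated.\<close>

lemma step_cross:
  assumes z: "below_top k z" and step: "step (k, Re z) (k', X')"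
  shows "\<exists>z'. cross \<alpha> l \<i> (k, z) (k', z') \<and> Re z' = X' \<and> below_top k' z'"
proof -
  have "\<bar>k' - k\<bar> = 1" using step by (simp add: step_def)
  then consider "k' = k + 1" | "k' = k - 1" by linarith
  then show ?thesis
  proof cases
    case 1
    obtain t where t: "t > 0" "coord k (z + of_real t * \<i>) = sgn (half_width k)"
      "\<bar>coord (k - 1) (z + of_real t * \<i>)\<bar> < 1 \<Longrightarrow>
         \<forall>s. 0 < s \<and> s < t \<longrightarrow> z + of_real s * \<i> \<in> interior (rhombus_copy \<alpha> l k)"
      by (rule exit_point[OF z, of "k - 1" k]) auto
    define w where "w = z + of_real t * \<i>"
    have w: "Re w = Re z" "coord k w = sgn (half_width k)" using t by (simp_all add: w_def)
    then have c: "\<bar>coord (k - 1) w\<bar> < 1" using window_up_iff[OF w(2)] w(1) step 1 by (simp add: step_def)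
    have one: "\<bar>coord k w\<bar> = 1" using w nonzero[of k] by (simp add: abs_sgn_eq)
    obtain z' where z': "coord (k + 1) z' = - coord (k - 1) w" "coord k z' = - coord k w"
      using coord_surj[of "k + 1"] by auto
    have g: "glue_next \<alpha> l (k, w) (k', z')" using z' 1 c one by (simp add: glue_next_iff)
    have "step (k, Re z) (k', Re z')" using glue_up[OF g w(2)] w by simp
    then have "(k', X') = (k', Re z')" by (rule step_deterministic[OF step])
    then have "Re z' = X'" by simp
    moreover have "cross \<alpha> l \<i> (k, z) (k', z')"
      unfolding cross_def using t c g by (auto simp: glued_def w_def)
    moreover have "below_top k' z'"
      by (rule below_topI[of "k + 1" k]) (use g c w 1 in \<open>auto simp: glue_next_iff\<close>)
    ultimately show ?thesis by blast
  next
    case 2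
    obtain t where t: "t > 0" "coord (k - 1) (z + of_real t * \<i>) = sgn (half_width (k - 1))"
      "\<bar>coord k (z + of_real t * \<i>)\<bar> < 1 \<Longrightarrow>
         \<forall>s. 0 < s \<and> s < t \<longrightarrow> z + of_real s * \<i> \<in> interior (rhombus_copy \<alpha> l k)"
      by (rule exit_point[OF z, of k "k - 1"]) auto
    define w where "w = z + of_real t * \<i>"
    have w: "Re w = Re z" "coord (k - 1) w = sgn (half_width (k - 1))" using t by (simp_all add: w_def)
    then have c: "\<bar>coord k w\<bar> < 1" using window_down_iff[OF w(2)] w(1) step 2 by (simp add: step_def)
    have one: "\<bar>coord (k - 1) w\<bar> = 1" using w nonzero[of "k - 1"] by (simp add: abs_sgn_eq)
    obtain z' where z': "coord (k - 1) z' = - coord (k - 1) w" "coord (k - 1 - 1) z' = - coord k w"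
      using coord_surj[of "k - 1"] by blast
    have g: "glue_next \<alpha> l (k', z') (k, w)" using z' 2 c one by (simp add: glue_next_iff)
    have "step (k, Re z) (k', Re z')" using glue_down[OF g w(2)] w by simp
    then have "(k', X') = (k', Re z')" by (rule step_deterministic[OF step])
    then have "Re z' = X'" by simp
    moreover have "cross \<alpha> l \<i> (k, z) (k', z')"
      unfolding cross_def using t c g by (auto simp: glued_def w_def)
    moreover have "below_top k' z'"
      by (rule below_topI[of "k' - 1" k']) (use z' c w 2 in auto)
    ultimately show ?thesis by blast
  qed
qed

end

section \<open>Perpendicular trajectories, strips and beams\<close>

context right_triangle
begin

lemma perp_trajectory_follows:
  assumes "perp_trajectory \<alpha> l x \<gamma>"
  shows "follows (code \<gamma>) x" "code \<gamma> 0 = 0" "Re (snd (\<gamma> n)) = x + displacement (code \<gamma>) n"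
proof -
  have 0: "\<gamma> 0 = (0, of_real x)" and c: "cross \<alpha> l \<i> (\<gamma> n) (\<gamma> (Suc n))" for n
    using assms by (auto simp: perp_trajectory_def trajectory_def)
  have s: "step (project (\<gamma> n)) (project (\<gamma> (Suc n)))" for n
    by (rule cross_step(1)[OF c])
  have f: "fst (project (\<gamma> n)) = code \<gamma> n" for n by (simp add: project_def code_def)
  show "follows (code \<gamma>) x" "Re (snd (\<gamma> n)) = x + displacement (code \<gamma>) n"
    using followsI[where P = "\<lambda>n. project (\<gamma> n)", OF s f] by (simp_all add: project_def 0)
  show "code \<gamma> 0 = 0" by (simp add: code_def 0)
qed

lemma passesI:
  assumes "perp_trajectory \<alpha> l x \<gamma>" "n > 0"
    and w: "w \<in> rhombus_copy \<alpha> l (code \<gamma> n)" "Re w = x + displacement (code \<gamma>) n"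
  shows "passes \<alpha> l \<i> \<gamma> n w"
proof -
  obtain m where n: "n = Suc m" using assms(2) by (cases n) auto
  have "cross \<alpha> l \<i> (\<gamma> m) (\<gamma> n)"
    using assms(1) by (auto simp: perp_trajectory_def trajectory_def n)
  moreover have re: "Re w = Re (snd (\<gamma> n))"
    using w(2) perp_trajectory_follows(3)[OF assms(1)] by simp
  ultimately have "Im (snd (\<gamma> n)) \<le> Im w"
    using cross_step(2) w(1) by (simp add: code_def)
  moreover have "w = snd (\<gamma> n) + of_real (Im w - Im (snd (\<gamma> n))) * \<i>"
    using re by (simp add: complex_eq_iff)
  ultimately show ?thesis
    unfolding passes_def using w(1) by (metis diff_ge_0_iff_ge)
qed

lemma window_zero_bound:
  assumes "\<bar>j\<bar> = 1" "X \<in> window 0 j"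
  shows "\<bar>X\<bar> < l"
  using assms(2) window_zero[OF assms(1)] l_pos by (auto simp: half_width_0 split: if_splits)

lemma follows_start:
  assumes "follows a x" "a 0 = 0"
  shows "\<bar>x\<bar> < l"
proof (rule window_zero_bound)
  show "\<bar>a 1\<bar> = 1" using follows_adjacent[OF assms(1), of 0] assms(2) by simp
  have "step (a 0, x + displacement a 0) (a (Suc 0), x + displacement a (Suc 0))"
    using assms(1) unfolding follows_def by blast
  then show "x \<in> window 0 (a 1)" by (simp add: step_def assms(2))
qed

lemma coord_of_real: "coord 0 (of_real x) = x / l" "coord (- 1) (of_real x) = - x / l"
  using trig_pos by (simp_all add: coord_def)

lemma of_real_in_rhombus:
  assumes "\<bar>x\<bar> \<le> l"
  shows "of_real x \<in> rhombus_copy \<alpha> l 0"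
  using assms l_pos by (simp add: rhombus_copy_iff coord_of_real abs_divide)

text \<open>Being in copy 0 at the initial abscissa means being on the initial vertical line, where
  the starting point is not below the entry point. So closing up depends on the code alone.\<close>

lemma returns_iff:
  assumes "perp_trajectory \<alpha> l x \<gamma>" "n > 0"
  shows "returns \<alpha> l \<i> \<gamma> n \<longleftrightarrow> code \<gamma> n = 0 \<and> displacement (code \<gamma>) n = 0"
proof
  note f = perp_trajectory_follows[OF assms(1)]
  have 0: "snd (\<gamma> 0) = of_real x"
    using assms(1) by (simp add: perp_trajectory_def trajectory_def)
  show "code \<gamma> n = 0 \<and> displacement (code \<gamma>) n = 0" if "returns \<alpha> l \<i> \<gamma> n"
  proof -
    from that obtain s where "of_real x = snd (\<gamma> n) + of_real s * \<i>" and c: "code \<gamma> n = 0"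
      using f(2) by (auto simp: returns_def passes_def 0)
    then have "x = Re (snd (\<gamma> n))"
      by (metis Re_complex_of_real plus_complex.sel(1) Re_i_times Im_complex_of_real mult.commute
          add.right_neutral neg_equal_0_iff_equal)
    then show ?thesis using f(3)[of n] c by simp
  qed
  show "returns \<alpha> l \<i> \<gamma> n" if "code \<gamma> n = 0 \<and> displacement (code \<gamma>) n = 0"
    unfolding returns_def 0 using that f(2) passesI[OF assms, of "of_real x"]
      of_real_in_rhombus[of x] follows_start[OF f(1,2)] by simp
qed

lemma exists_perp_trajectory:
  assumes "follows a x" "a 0 = 0"
  obtains \<gamma> where "perp_trajectory \<alpha> l x \<gamma>" "code \<gamma> = a"
proof -
  \<comment> \<open>The clause \<open>below_top\<close> lets \<open>step_cross\<close> extend the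
    path; the clause for \<open>n = 0\<close> fixes the start.\<close>
  define P where "P n S \<longleftrightarrow> fst S = a n \<and> Re (snd S) = x + displacement a n \<and>
    below_top (fst S) (snd S) \<and> (n = 0 \<longrightarrow> S = (0, of_real x))" for n and S :: "int \<times> complex"
  have "\<exists>\<gamma>. \<forall>n. P n (\<gamma> n) \<and> cross \<alpha> l \<i> (\<gamma> n) (\<gamma> (Suc n))"
  proof (rule dependent_nat_choice)
    have "\<bar>x\<bar> < l" by (rule follows_start[OF assms])
    then have "x / l < 1" "- 1 < x / l" using l_pos by (simp_all add: abs_less_iff field_simps)
    moreover have "sgn (half_width j) = 1 \<or> sgn (half_width j) = - 1" for j
      using nonzero[of j] by (auto simp: sgn_if)
    from this[of 0] this[of "- 1"] calculation have "below_top 0 (of_real x)"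
      by (auto simp: below_top_def coord_of_real)
    then show "\<exists>S. P 0 S" unfolding P_def using assms(2) by (intro exI[of _ "(0, of_real x)"]) simp
  next
    fix S n assume S: "P n S"
    have "step (fst S, Re (snd S)) (a (Suc n), x + displacement a (Suc n))"
      using S assms(1) by (simp add: P_def follows_def)
    from step_cross[OF _ this] S show "\<exists>S'. P (Suc n) S' \<and> cross \<alpha> l \<i> S S'"
      by (auto simp: P_def)
  qed
  then obtain \<gamma> where \<gamma>: "\<And>n. P n (\<gamma> n)" "\<And>n. cross \<alpha> l \<i> (\<gamma> n) (\<gamma> (Suc n))" by blast
  have "perp_trajectory \<alpha> l x \<gamma>"
    using \<gamma>(1)[of 0] \<gamma>(2) by (simp add: perp_trajectory_def trajectory_def P_def)
  moreover have "code \<gamma> = a" using \<gamma>(1) by (auto simp: code_def P_def)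
  ultimately show thesis by (rule that)
qed

text \<open>For a given code only countably many starting points ever reach abscissa 0, that is, a
  centre.\<close>

lemma generic_point:
  assumes "c < (d::real)"
  obtains x where "c < x" "x < d" "\<And>n. x + displacement a n \<noteq> 0"
proof -
  have "uncountable {c<..<d}" using assms by (simp add: uncountable_open_interval)
  moreover have "countable (range (\<lambda>n. - displacement a n))" by simp
  ultimately have "\<not> {c<..<d} \<subseteq> range (\<lambda>n. - displacement a n)"
    using countable_subset by blast
  then obtain x where x: "x \<in> {c<..<d}" "x \<notin> range (\<lambda>n. - displacement a n)" by blast
  then have "x + displacement a n \<noteq> 0" for n
    by (auto simp: add_eq_0_iff2)
  with x that show thesis by auto
qed

text \<open>Periodicity is a condition on the code, so it moves out of the quantifier over starting
  points.\<close>

lemma perp_strip_iff: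
  "perp_strip \<alpha> l u v a \<longleftrightarrow> - l \<le> u \<and> u < v \<and> v \<le> l \<and> a 0 = 0 \<and> (\<forall>x\<in>{u<..<v}. follows a x) \<and>
     (\<exists>n>0. a n = 0 \<and> displacement a n = 0)"
proof
  assume strip: "perp_strip \<alpha> l u v a"
  then have uv: "- l \<le> u" "u < v" "v \<le> l"
    and ex: "\<And>x. x \<in> {u<..<v} \<Longrightarrow> \<exists>\<gamma>. perp_trajectory \<alpha> l x \<gamma> \<and> periodic \<alpha> l \<i> \<gamma> \<and> code \<gamma> = a"
    by (auto simp: perp_strip_def)
  have "follows a x \<and> a 0 = 0" if "x \<in> {u<..<v}" for x
    using ex[OF that] perp_trajectory_follows by blast
  moreover obtain x where x: "x \<in> {u<..<v}" using uv(2) dense by auto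
  moreover from ex[OF x] obtain \<gamma> n where "perp_trajectory \<alpha> l x \<gamma>" "code \<gamma> = a" "n > 0" "returns \<alpha> l \<i> \<gamma> n"
    by (auto simp: periodic_def)
  then have "\<exists>n>0. a n = 0 \<and> displacement a n = 0"
    using returns_iff by blast
  ultimately show "- l \<le> u \<and> u < v \<and> v \<le> l \<and> a 0 = 0 \<and> (\<forall>x\<in>{u<..<v}. follows a x) \<and>
     (\<exists>n>0. a n = 0 \<and> displacement a n = 0)" using uv by blast
next
  assume *: "- l \<le> u \<and> u < v \<and> v \<le> l \<and> a 0 = 0 \<and> (\<forall>x\<in>{u<..<v}. follows a x) \<and>
     (\<exists>n>0. a n = 0 \<and> displacement a n = 0)"
  have "\<exists>\<gamma>. perp_trajectory \<alpha> l x \<gamma> \<and> periodic \<alpha> l \<i> \<gamma> \<and> code \<gamma> = a" if "x \<in> {u<..<v}" for x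
  proof -
    obtain \<gamma> where \<gamma>: "perp_trajectory \<alpha> l x \<gamma>" "code \<gamma> = a"
      using exists_perp_trajectory[of a x] * \<open>x \<in> {u<..<v}\<close> by blast
    then have "periodic \<alpha> l \<i> \<gamma>"
      unfolding periodic_def using returns_iff[OF \<gamma>(1)] * by blast
    with \<gamma> show ?thesis by blast
  qed
  with * show "perp_strip \<alpha> l u v a" by (auto simp: perp_strip_def)
qed

lemma beam_orbit:
  assumes strip: "perp_strip \<alpha> l u v a" and per: "beam_period \<alpha> l u v (2 * p)"
    and x: "u < x" "x < v"
  shows "perpendicular_orbit half_width a x p"
proof -
  note s = strip[unfolded perp_strip_iff]
  have fx: "follows a x" using s x by simp
  obtain \<gamma> where \<gamma>: "perp_trajectory \<alpha> l x \<gamma>" "code \<gamma> = a"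
    using exists_perp_trajectory[OF fx] s by blast
  let ?R = "\<lambda>n. n > 0 \<and> returns \<alpha> l \<i> \<gamma> n"
  have R: "?R n \<longleftrightarrow> n > 0 \<and> a n = 0 \<and> displacement a n = 0" for n
    using returns_iff[OF \<gamma>(1)] \<gamma>(2) by blast
  have least: "2 * p = (LEAST n. ?R n)"
    using per x \<gamma>(1) by (auto simp: beam_period_def period_def)
  have "\<exists>n. ?R n" using s R by blast
  then have "?R (2 * p)" unfolding least by (rule LeastI_ex)
  moreover have "\<not> ?R n" if "n < 2 * p" for n
    using that unfolding least by (rule not_less_Least)
  ultimately show ?thesis
    using R[of "2 * p"] R s fx by unfold_locales auto
qed

text \<open>By maximality the strip between \<open>x\<close> and the reflected return point of \<open>x\<close> is part of the
  beam.\<close>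

lemma beam_return:
  assumes beam: "perp_periodic_beam \<alpha> l u v a" and per: "beam_period \<alpha> l u v (2 * p)"
    and x: "u < x" "x < v" and generic: "\<And>n. x + displacement a n \<noteq> 0"
  shows "u \<le> - (x + displacement a p)" "- (x + displacement a p) \<le> v"
proof -
  have strip: "perp_strip \<alpha> l u v a" using beam by (simp add: perp_periodic_beam_def)
  note s = strip[unfolded perp_strip_iff]
  interpret perpendicular_orbit half_width a x p by (rule beam_orbit[OF strip per x])
  have y: "y = - (x + displacement a p)" by (rule y_def)
  have yl: "\<bar>y\<bar> < l" by (rule window_zero_bound[OF first_label return_window])
  \<comment> \<open>The interval is enlarged just enough to reach \<open>y\<close>; the interior
    points added lie between \<open>x\<close> and \<open>y\<close>.\<close>
  define u' v' where "u' = min u y" and "v' = max v y"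
  have fol: "follows a Z" if "u' < Z" "Z < v'" for Z
  proof (cases "u < Z \<and> Z < v")
    case False
    with that x have "min x y < Z" "Z < max x y"
      by (auto simp: u'_def v'_def min_def max_def split: if_splits)
    then show ?thesis by (rule follows_between[OF generic])
  qed (use s in auto)
  have "perp_strip \<alpha> l u' v' a"
    unfolding perp_strip_iff using s yl fol by (auto simp: u'_def v'_def)
  moreover have "{u<..<v} \<subseteq> {u'<..<v'}" by (auto simp: u'_def v'_def)
  ultimately have "u' = u \<and> v' = v" using beam unfolding perp_periodic_beam_def by blast
  then show "u \<le> - (x + displacement a p)" "- (x + displacement a p) \<le> v"
    by (auto simp: u'_def v'_def y)
qed

text \<open>By \<open>beam_return\<close> the reflection
  \<open>x \<mapsto> - (x + displacement a p)\<close> takes generic points of the beam into its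
  closure. If its fixed point were not the midpoint, generic points near one end would be taken
  outside.\<close>

lemma beam_displacement:
  assumes beam: "perp_periodic_beam \<alpha> l u v a" and per: "beam_period \<alpha> l u v (2 * p)"
  shows "displacement a p = - (u + v)"
proof (rule ccontr)
  assume neq: "displacement a p \<noteq> - (u + v)"
  define d where "d = - (u + v) - displacement a p"
  have "u < v" using beam by (auto simp: perp_periodic_beam_def perp_strip_def)
  consider "d > 0" | "d < 0" using neq unfolding d_def by linarith
  then show False
  proof cases
    case 1
    \<comment> \<open>\<open>x\<close> is taken to \<open>u + v + d - x\<close>, which exceeds
      \<open>v\<close> once \<open>x < u + d\<close>.\<close>
    then have "u < min v (u + d)" using \<open>u < v\<close> by simp
    then obtain x where "u < x" "x < min v (u + d)" "\<And>n. x + displacement a n \<noteq> 0"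
      using generic_point by blast
    with beam_return(2)[OF beam per, of x] show False by (simp add: d_def)
  next
    case 2
    then have "max u (v + d) < v" using \<open>u < v\<close> by simp
    then obtain x where "max u (v + d) < x" "x < v" "\<And>n. x + displacement a n \<noteq> 0"
      using generic_point by blast
    with beam_return(1)[OF beam per, of x] show False by (simp add: d_def)
  qed
qed

end

theorem theorem1:
  fixes \<alpha> l u v m :: real and a :: "nat \<Rightarrow> int" and p :: nat
  assumes "l > 0"
    and "irrational_angle \<alpha>"
    and "pi / 6 < \<alpha>" and "\<alpha> < pi / 4"
    and "perp_periodic_beam \<alpha> l u v a"
    and "beam_period \<alpha> l u v (2 * p)"
    and "m = (u + v) / 2"
  shows "(\<forall>\<gamma>. perp_trajectory \<alpha> l m \<gamma> \<longrightarrow>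
            (\<exists>n w. passes \<alpha> l \<i> \<gamma> n w \<and> to_triangle \<alpha> (code \<gamma> n, w) = 0))
       \<and> (\<forall>t. \<bar>t\<bar> < (v - u) / 2 \<longrightarrow>
            (\<forall>\<gamma>. perp_trajectory \<alpha> l (m + t) \<gamma> \<longrightarrow>
              orthogonal \<i> (rot \<alpha> (code \<gamma> p)) \<and>
              (\<exists>w\<in>diagonal_copy \<alpha> l (code \<gamma> p). passes \<alpha> l \<i> \<gamma> p w \<and>
                 to_triangle \<alpha> (code \<gamma> p, w) = to_triangle \<alpha> (0, of_real (m - t)))))
       \<and> (even p \<and> rev (map a [0..<p + 1]) = map a [0..<p + 1])"
proof -
  interpret right_triangle \<alpha> l
  proof
    show "0 < \<alpha>" "\<alpha> < pi / 2" using assms(3,4) pi_gt_zero by linarith+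
    fix k :: int
    show "cos ((2 * of_int k + 1) * \<alpha>) \<noteq> 0"
    proof
      assume "cos ((2 * of_int k + 1) * \<alpha>) = 0"
      then obtain i where "(2 * of_int k + 1) * \<alpha> = of_int i * (pi / 2)"
        unfolding cos_zero_iff_int by blast
      moreover have "2 * k + 1 \<noteq> 0" by presburger
      then have "(2 * of_int k + 1 :: real) \<noteq> 0"
        by (metis of_int_0_eq_iff of_int_1 of_int_add of_int_mult of_int_numeral)
      ultimately have "\<alpha> / pi = of_int i / of_int (2 * (2 * k + 1))"
        by (simp add: field_simps)
      then have "\<alpha> / pi \<in> \<rat>" by simp
      with assms(2) show False by (simp add: irrational_angle_def)
    qed
  qed (rule assms(1))
  note beam = assms(5) and per = assms(6) and m = assms(7)
  have strip: "perp_strip \<alpha> l u v a" using beam by (simp add: perp_periodic_beam_def)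
  note s = strip[unfolded perp_strip_iff]
  have uv: "u < v" using s by simp
  have D: "displacement a p = - 2 * m" using beam_displacement[OF beam per] m by simp
  have mid: "u < m" "m < v" using uv m by simp_all
  interpret perpendicular_orbit half_width a m p by (rule beam_orbit[OF strip per mid])
  \<comment> \<open>The orbit of \<open>m\<close> may hit a centre, but
    \<open>beam_displacement\<close> holds for the code; so \<open>y = m\<close> and this orbit is
    its own reversal.\<close>
  have y: "y = m" by (simp add: y_def D)
  have fm: "follows a m" by (rule follows)
  have sym: "a (p - n) = a n" "m + displacement a (p - n) = - (m + displacement a n)" if "n \<le> p" for n
    using reversed_orbit[OF _ that] fm y by simp_all
  have "even p" using follows_parity[OF fm, of p] by (simp add: half_period start)
  have code: "code \<gamma> = a" if "perp_trajectory \<alpha> l x \<gamma>" "u < x" "x < v" for \<gamma> x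
    using follows_unique[OF perp_trajectory_follows(1)[OF that(1)], of a] that s
      perp_trajectory_follows(2)[OF that(1)] by simp
  have "\<exists>n w. passes \<alpha> l \<i> \<gamma> n w \<and> to_triangle \<alpha> (code \<gamma> n, w) = 0"
    if \<gamma>: "perp_trajectory \<alpha> l m \<gamma>" for \<gamma>
  proof -
    \<comment> \<open>The time \<open>p div 2\<close> is fixed by \<open>n \<mapsto> p - n\<close>,
      so the abscissa there equals its negative and the orbit passes through a centre.\<close>
    have "p - p div 2 = p div 2" "p div 2 > 0" using \<open>even p\<close> p_pos by auto
    then have "m + displacement (code \<gamma>) (p div 2) = 0"
      using sym(2)[of "p div 2"] code[OF \<gamma> mid] by simp
    then have "passes \<alpha> l \<i> \<gamma> (p div 2) 0"
      using passesI[OF \<gamma> \<open>p div 2 > 0\<close>, of 0] by (simp add: rhombus_copy_iff coord_def)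
    moreover have "to_triangle \<alpha> (code \<gamma> (p div 2), 0) = 0"
      by (simp add: to_triangle_def complex_eq_iff)
    ultimately show ?thesis by blast
  qed
  moreover have "orthogonal \<i> (rot \<alpha> (code \<gamma> p)) \<and>
      (\<exists>w\<in>diagonal_copy \<alpha> l (code \<gamma> p). passes \<alpha> l \<i> \<gamma> p w \<and>
         to_triangle \<alpha> (code \<gamma> p, w) = to_triangle \<alpha> (0, of_real (m - t)))"
    if t: "\<bar>t\<bar> < (v - u) / 2" and \<gamma>: "perp_trajectory \<alpha> l (m + t) \<gamma>" for t \<gamma>
  proof -
    have range: "u < m + t" "m + t < v" "u < m - t" "m - t < v"
      using t m by (auto simp: abs_less_iff field_simps)
    have a: "code \<gamma> = a" by (rule code[OF \<gamma> range(1,2)])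
    have bound: "\<bar>t - m\<bar> \<le> l" using range s by auto
    \<comment> \<open>The displacement \<open>- 2 * m\<close> brings \<open>m + t\<close> to
      \<open>t - m\<close>, which folding identifies with \<open>m - t\<close>.\<close>
    have "passes \<alpha> l \<i> \<gamma> p (of_real (t - m))"
      by (rule passesI[OF \<gamma> p_pos]) (use of_real_in_rhombus[OF bound] in \<open>auto simp: a half_period D\<close>)
    moreover have "t - m \<in> closed_segment (- l) l"
      using bound by (auto simp: closed_segment_eq_real_ivl)
    then have "of_real (t - m) \<in> closed_segment (of_real (- l)) (of_real l :: complex)"
      unfolding closed_segment_of_real by (rule imageI)
    then have "of_real (t - m) \<in> diagonal_copy \<alpha> l 0"
      by (simp add: diagonal_copy_def)
    moreover have "to_triangle \<alpha> (0, of_real (t - m)) = to_triangle \<alpha> (0, of_real (m - t))"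
      by (simp add: to_triangle_def abs_minus_commute)
    ultimately show ?thesis
      by (intro conjI bexI[of _ "of_real (t - m)"]) (simp_all add: a half_period orthogonal_def inner_complex_def)
  qed
  moreover have "rev (map a [0..<p + 1]) = map a [0..<p + 1]"
    by (rule nth_equalityI) (auto simp: rev_nth sym(1) simp del: upt_Suc)
  ultimately show ?thesis using \<open>even p\<close> by blast
qed

end
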